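(* Let $\sigma\in(1/2,1)$ and let $A\subset[1,2]$ be a $(\delta,\sigma)$-set with Lebesgue measure $|A|=\delta^{1-\sigma}$. Then $$|A+A|+|AA|\gtrapprox \delta^{-\frac{(1-\sigma)(2\sigma-1)}{6\sigma+4}}\,|A|.$$
   Context: Notation. $|S|$ denotes the Lebesgue measure of $S\subset\mathbb{R}$; $A+B=\{a+b:a\in A,b\in B\}$, $AB=\{ab:a\in A,b\in B\}$; $B(x,r)$ is the ball (interval) of center $x$ and radius $r$ in $\mathbb{R}$. Asymptotic notation (Katz–Tao). $\epsilon,\delta$ are small positive parameters. $f\lessapprox g$ means $|f|\le C_\epsilon\delta^{-C\epsilon}|g|$, where the constant $C$ depends on neither $\epsilon$ nor $\delta$ and the constant $C_\epsilon$ may depend on $\epsilon$ but not on $\delta$; $f\gtrapprox g$ means $g\lessapprox f$; $f\approx g$ means both $f\lessapprox g$ and $f\gtrapprox g$. The constants may differ at each occurrence: if the hypotheses hold with given constants, the conclusion holds with (possibly larger) constants depending only on those constants and on the fixed exponent $\sigma$ (and, for $C_\epsilon$, on $\epsilon$), and in particular uniformly in $A$ and in all sufficiently small $\delta$. Definitions. A set $A\subset\mathbb{R}$ is $\delta$-discretized if it is a union of intervals of lengths $\approx\delta$. For $M>0$ a constant, a set $A\subset(-M,M)$ is a $(\delta,\sigma)$-set if it is $\delta$-discretized, has positive measure, and $$|A\cap B(x,r)|\lessapprox\delta(r/\delta)^\sigma\quad\text{for all }\delta\le r<1\text{ and }x\in\mathbb{R}.$$ *)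

theory Defs
  imports "HOL-Analysis.Analysis" "HOL-Library.Set_Algebras"
begin

text \<open>
  The Katz--Tao notation, with its implicit constants made explicit: \<open>C\<close> is the constant
  in the exponent and \<open>K \<epsilon>\<close> is the constant \<open>C\<^sub>\<epsilon>\<close>.  Neither may depend on \<open>\<delta>\<close>, and \<open>C\<close> may not
  depend on \<open>\<epsilon>\<close>; this is enforced by the order of quantifiers wherever the notation is used.
\<close>

definition lessapprox ::
    "real \<Rightarrow> (real \<Rightarrow> real) \<Rightarrow> real \<Rightarrow> real \<Rightarrow> real \<Rightarrow> real \<Rightarrow> bool" where
  "lessapprox C K \<epsilon> \<delta> f g \<longleftrightarrow> \<bar>f\<bar> \<le> K \<epsilon> * \<delta> powr (- (C * \<epsilon>)) * \<bar>g\<bar>"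

definition approx ::
    "real \<Rightarrow> (real \<Rightarrow> real) \<Rightarrow> real \<Rightarrow> real \<Rightarrow> real \<Rightarrow> real \<Rightarrow> bool" where
  "approx C K \<epsilon> \<delta> f g \<longleftrightarrow> lessapprox C K \<epsilon> \<delta> f g \<and> lessapprox C K \<epsilon> \<delta> g f"

text \<open>
  Intervals may be open, closed or half-open, and the union is arbitrary.  An unbounded
  interval has \<open>measure lebesgue I = 0\<close> by the convention for infinite measure, so for
  \<open>\<delta> > 0\<close> it is excluded, like a degenerate one, by the lower bound on the length.
\<close>

definition delta_discretized ::
    "real \<Rightarrow> (real \<Rightarrow> real) \<Rightarrow> real \<Rightarrow> real \<Rightarrow> real set \<Rightarrow> bool" where
  "delta_discretized C K \<epsilon> \<delta> A \<longleftrightarrow>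
     (\<exists>\<I>. A = \<Union>\<I> \<and>
       (\<forall>I\<in>\<I>. is_interval I \<and> approx C K \<epsilon> \<delta> (measure lebesgue I) \<delta>))"

text \<open>
  One pair \<open>(C, K)\<close> serves all occurrences of the notation below.  This is no restriction:
  for \<open>\<delta> < 1\<close> the bounds get weaker as the constants grow, so different constants at
  different occurrences can be replaced by their maximum.
\<close>

definition delta_sigma_set ::
    "real \<Rightarrow> real \<Rightarrow> (real \<Rightarrow> real) \<Rightarrow> real \<Rightarrow> real \<Rightarrow> real \<Rightarrow> real set \<Rightarrow> bool" where
  "delta_sigma_set M C K \<epsilon> \<delta> \<sigma> A \<longleftrightarrow>
     A \<subseteq> {-M<..<M} \<and>
     delta_discretized C K \<epsilon> \<delta> A \<and>
     measure lebesgue A > 0 \<and>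
     (\<forall>r x. \<delta> \<le> r \<and> r < 1 \<longrightarrow>
        lessapprox C K \<epsilon> \<delta> (measure lebesgue (A \<inter> ball x r)) (\<delta> * (r / \<delta>) powr \<sigma>))"

end

(*
A measure-theoretic version of Elekes' argument, with an L2 estimate in place of the incidence
theorem of Szemeredi and Trotter.  Let alpha = |A|, P = AA x (A+A), f = 1_A, and count
  T(t) = int over a in A and (y, x) in P of f(x - t - y/a).
The points (ab, b + c) show T(0) >= alpha^3.  Averaging t over [0, rho] gives at most
alpha |P| B rho^(sigma-1), where |A n I| <= B |I|^sigma for all intervals I and B is nearly alpha.
With g(u) = f(u) - f(u - t), Cauchy-Schwarz bounds T(0) - T(t) by |P|^(1/2) S^(1/2), where S
integrates g(x - y/a) g(x - y/b) over a, b in A, over all x and over y in [1,4].  Substituting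
u = x - y/a turns the second factor into g(u + s y) with s = 1/a - 1/b, whose integral in y is at
most B min(t, 3|s|)^sigma / |s|, which is O(B rho^(sigma-1/2) |a-b|^(-1/2)); and
the energy of |a-b|^(-1/2) on A is finite since sigma > 1/2.  The choice rho = alpha^2 balances
the two terms and yields |P| >~ alpha^(3 - 2 sigma), hence the exponent
(1-sigma)(2 sigma-1)/2, which is larger than the required one.
*)

theory Submission
  imports Defs
begin

section \<open>Borel measurability of unions of nondegenerate intervals\<close>

text \<open>Each such \<open>x\<close> owns a rational \<open>q x\<close> with
  \<open>{x<..q x}\<close> inside \<open>U\<close>. If \<open>x < y\<close> shared one, then
  \<open>y\<close> would lie in \<open>{x<..q x}\<close> and hence in \<open>U\<close>, which is
  excluded; so \<open>q\<close> is injective.\<close>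

lemma countable_right_accessible:
  fixes U :: "real set"
  shows "countable {x. x \<notin> U \<and> (\<exists>y>x. {x<..<y} \<subseteq> U)}"
proof -
  define E where "E = {x. x \<notin> U \<and> (\<exists>y>x. {x<..<y} \<subseteq> U)}"
  have "\<forall>x\<in>E. \<exists>q\<in>\<rat>. x < q \<and> {x<..q} \<subseteq> U"
  proof
    fix x assume "x \<in> E"
    then obtain y where y: "x < y" "{x<..<y} \<subseteq> U" by (auto simp: E_def)
    obtain q where "q \<in> \<rat>" "x < q" "q < y" using Rats_dense_in_real[OF y(1)] by blast
    then show "\<exists>q\<in>\<rat>. x < q \<and> {x<..q} \<subseteq> U" using y(2) by force
  qed
  then obtain q where q: "\<And>x. x \<in> E \<Longrightarrow> q x \<in> \<rat> \<and> x < q x \<and> {x<..q x} \<subseteq> U" by metis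
  have "inj_on q E"
  proof (rule linorder_inj_onI)
    fix x y assume "x < y" "x \<in> E" "y \<in> E"
    show "q x \<noteq> q y"
    proof
      assume "q x = q y"
      then have "y \<in> {x<..q x}" using q[OF \<open>y \<in> E\<close>] \<open>x < y\<close> by auto
      then have "y \<in> U" using q[OF \<open>x \<in> E\<close>] by blast
      then show False using \<open>y \<in> E\<close> by (simp add: E_def)
    qed
  qed auto
  moreover have "countable (q ` E)"
    by (rule countable_subset[OF _ countable_rat]) (use q in auto)
  ultimately show ?thesis unfolding E_def[symmetric] using countable_image_inj_on by blast
qed

text \<open>Reflection in the origin exchanges the two sides.\<close>

lemma countable_left_accessible:
  fixes U :: "real set"
  shows "countable {x. x \<notin> U \<and> (\<exists>y<x. {y<..<x} \<subseteq> U)}" (is "countable ?E")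
proof -
  have "?E \<subseteq> uminus ` {x. x \<notin> uminus ` U \<and> (\<exists>y>x. {x<..<y} \<subseteq> uminus ` U)}"
  proof
    fix x assume x: "x \<in> ?E"
    then obtain y where y: "y < x" "{y<..<x} \<subseteq> U" by auto
    have "{-x<..<-y} \<subseteq> uminus ` U"
    proof
      fix z assume "z \<in> {-x<..<-y}"
      then have "-z \<in> U" using y by auto
      then show "z \<in> uminus ` U" by (metis image_eqI minus_minus)
    qed
    then have "-x \<in> {x. x \<notin> uminus ` U \<and> (\<exists>y>x. {x<..<y} \<subseteq> uminus ` U)}"
      using x y(1) by (auto intro!: exI[of _ "-y"])
    then show "x \<in> uminus ` {x. x \<notin> uminus ` U \<and> (\<exists>y>x. {x<..<y} \<subseteq> uminus ` U)}"
      by (metis (no_types, lifting) image_eqI minus_minus)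
  qed
  then show ?thesis
    using countable_right_accessible countable_image countable_subset by blast
qed

text \<open>The union of the interiors is open, and what it misses consists of endpoints accessible
  from one side, of which there are only countably many.\<close>

lemma Union_nondegenerate_intervals_borel:
  fixes \<I> :: "real set set"
  assumes "\<And>I. I \<in> \<I> \<Longrightarrow> is_interval I"
    and "\<And>I. I \<in> \<I> \<Longrightarrow> \<exists>x\<in>I. \<exists>y\<in>I. x < y"
  shows "\<Union>\<I> \<in> sets borel"
proof -
  define U where "U = interior (\<Union>\<I>)"
  define D where "D = {x. x \<notin> U \<and> (\<exists>y>x. {x<..<y} \<subseteq> U)} \<union> {x. x \<notin> U \<and> (\<exists>y<x. {y<..<x} \<subseteq> U)}"
  have sub: "{x<..<y} \<subseteq> U" if "I \<in> \<I>" "x \<in> I" "y \<in> I" for I x y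
  proof -
    have "{x<..<y} \<subseteq> I"
      using assms(1)[OF that(1)] that unfolding is_interval_1 by (meson greaterThanLessThan_iff less_le subsetI)
    then show ?thesis unfolding U_def using that(1)
      by (intro interior_maximal) auto
  qed
  have "\<Union>\<I> \<subseteq> U \<union> D"
  proof
    fix x assume "x \<in> \<Union>\<I>"
    then obtain I where I: "I \<in> \<I>" "x \<in> I" by auto
    obtain y z where yz: "y \<in> I" "z \<in> I" "y < z" using assms(2)[OF I(1)] by auto
    then consider "x < z" | "y < x" by linarith
    then show "x \<in> U \<union> D"
    proof cases
      case 1
      with sub[OF I(1) I(2) yz(2)] show ?thesis unfolding D_def by auto
    next
      case 2
      with sub[OF I(1) yz(1) I(2)] show ?thesis unfolding D_def by auto
    qed
  qed
  then have eq: "\<Union>\<I> = U \<union> (D \<inter> \<Union>\<I>)"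
    using interior_subset unfolding U_def by blast
  have "countable D"
    unfolding D_def using countable_right_accessible countable_left_accessible by auto
  have "D \<inter> \<Union>\<I> \<in> sets borel"
    by (rule sets.countable[OF _ countable_subset[OF Int_lower1 \<open>countable D\<close>]]) simp
  moreover have "U \<in> sets borel" by (simp add: U_def)
  ultimately have "U \<union> (D \<inter> \<Union>\<I>) \<in> sets borel" by (rule sets.Un[rotated])
  then show ?thesis by (simp only: eq[symmetric])
qed

text \<open>Sums and products of arbitrary Borel sets can fail to be Borel; here the interval
  structure helps. The image of \<open>I \<times> J\<close> is connected, hence an interval, and
  strict monotonicity in the first variable keeps it nondegenerate, so the image is again a union of
  the kind just treated.\<close>

lemma borel_image2_nondegenerate_intervals:
  fixes h :: "real \<Rightarrow> real \<Rightarrow> real"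
  assumes \<I>: "\<And>I. I \<in> \<I> \<Longrightarrow> is_interval I" "\<And>I. I \<in> \<I> \<Longrightarrow> \<exists>x\<in>I. \<exists>y\<in>I. x < y"
    and cont: "continuous_on (\<Union>\<I> \<times> \<Union>\<I>) (\<lambda>(x, y). h x y)"
    and mono: "\<And>x x' y. x \<in> \<Union>\<I> \<Longrightarrow> x' \<in> \<Union>\<I> \<Longrightarrow> y \<in> \<Union>\<I> \<Longrightarrow> x < x' \<Longrightarrow> h x y < h x' y"
  shows "{h x y |x y. x \<in> \<Union>\<I> \<and> y \<in> \<Union>\<I>} \<in> sets borel"
proof -
  define \<J> where "\<J> = {(\<lambda>(x, y). h x y) ` (I \<times> J) |I J. I \<in> \<I> \<and> J \<in> \<I>}"
  have "{h x y |x y. x \<in> \<Union>\<I> \<and> y \<in> \<Union>\<I>} = \<Union>\<J>"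
  proof (intro equalityI subsetI)
    fix z assume "z \<in> {h x y |x y. x \<in> \<Union>\<I> \<and> y \<in> \<Union>\<I>}"
    then obtain x y I J where "z = h x y" "I \<in> \<I>" "x \<in> I" "J \<in> \<I>" "y \<in> J" by auto
    then have "z \<in> (\<lambda>(x, y). h x y) ` (I \<times> J)" "(\<lambda>(x, y). h x y) ` (I \<times> J) \<in> \<J>"
      unfolding \<J>_def by blast+
    then show "z \<in> \<Union>\<J>" by blast
  qed (auto simp: \<J>_def)
  moreover have "\<Union>\<J> \<in> sets borel"
  proof (rule Union_nondegenerate_intervals_borel)
    fix L assume "L \<in> \<J>"
    then obtain I J where L: "L = (\<lambda>(x, y). h x y) ` (I \<times> J)" and IJ: "I \<in> \<I>" "J \<in> \<I>"
      by (auto simp: \<J>_def)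
    have "connected (I \<times> J)"
      using \<I>(1) IJ by (intro connected_Times is_interval_connected) auto
    moreover have "continuous_on (I \<times> J) (\<lambda>(x, y). h x y)"
      by (rule continuous_on_subset[OF cont]) (use IJ in auto)
    ultimately show "is_interval L"
      unfolding L is_interval_connected_1 using connected_continuous_image by blast
    obtain x x' y where "x \<in> I" "x' \<in> I" "x < x'" "y \<in> J" using \<I>(2) IJ by metis
    then have "h x y \<in> L" "h x' y \<in> L" "h x y < h x' y" using IJ mono by (auto simp: L image_iff)
    then show "\<exists>x\<in>L. \<exists>y\<in>L. x < y" by blast
  qed
  ultimately show ?thesis by simp
qed

section \<open>Lebesgue measure concentrated on a set\<close>

text \<open>A density instead of a restricted space: the space stays \<open>UNIV\<close> and the
  sigma-algebra stays \<open>borel\<close> for every \<open>S\<close>, so measurability proofs look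
  the same for all the measures used below.\<close>

definition leb_on :: "real set \<Rightarrow> real measure" where
  "leb_on S = density lborel (\<lambda>x. ennreal (indicator S x))"

lemma sets_leb_on [measurable_cong, simp]: "sets (leb_on S) = sets borel"
  and space_leb_on [simp]: "space (leb_on S) = UNIV"
  by (simp_all add: leb_on_def)

lemma integral_leb_on:
  fixes f :: "real \<Rightarrow> real"
  assumes [measurable]: "S \<in> sets borel" "f \<in> borel_measurable borel"
  shows "integral\<^sup>L (leb_on S) f = (\<integral>x. indicator S x * f x \<partial>lborel)"
  unfolding leb_on_def by (subst integral_density) auto

lemma nn_integral_leb_on:
  fixes f :: "real \<Rightarrow> ennreal"
  assumes [measurable]: "S \<in> sets borel" "f \<in> borel_measurable borel"
  shows "integral\<^sup>N (leb_on S) f = (\<integral>\<^sup>+x. indicator S x * f x \<partial>lborel)"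
  unfolding leb_on_def by (subst nn_integral_density) (auto simp: ennreal_indicator)

lemma finite_measure_leb_on:
  assumes [measurable]: "S \<in> sets borel" and "bounded S"
  shows "finite_measure (leb_on S)"
proof (rule finite_measureI)
  have "emeasure (leb_on S) UNIV = emeasure lborel S"
    unfolding leb_on_def by (subst emeasure_density) (auto simp: ennreal_indicator)
  then show "emeasure (leb_on S) (space (leb_on S)) \<noteq> \<infinity>"
    using emeasure_bounded_finite[OF assms(2)] by simp
qed

lemma measure_leb_on_UNIV:
  assumes [measurable]: "S \<in> sets borel"
  shows "measure (leb_on S) UNIV = measure lborel S"
  unfolding leb_on_def measure_def by (subst emeasure_density) (auto simp: ennreal_indicator)

lemma AE_leb_on:
  assumes "S \<in> sets borel" "\<And>x. x \<in> S \<Longrightarrow> P x"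
  shows "AE x in leb_on S. P x"
  unfolding leb_on_def using assms by (subst AE_density) (auto simp: indicator_def)

lemma AE_leb_on_neq:
  assumes "S \<in> sets borel" 
  shows "AE x in leb_on S. x \<noteq> c"
  unfolding leb_on_def using assms AE_lborel_singleton[of c] by (subst AE_density) auto

section \<open>Frostman sets and the cancellation in 1_A(u) - 1_A(u - t)\<close>

text \<open>For a Borel set \<open>A\<close> of finite measure the integral over the whole line is
  0. Over an interval much longer than \<open>t\<close> most of this cancellation survives.\<close>

definition shift_diff :: "real set \<Rightarrow> real \<Rightarrow> real \<Rightarrow> real" where
  "shift_diff A t u = indicator A u - indicator A (u - t)"

lemma shift_diff_measurable [measurable]:
  assumes [measurable]: "A \<in> sets borel"
  shows "shift_diff A t \<in> borel_measurable borel"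
  unfolding shift_diff_def[abs_def] by measurable

lemma abs_shift_diff_le_1: "\<bar>shift_diff A t u\<bar> \<le> 1"
  by (auto simp: shift_diff_def indicator_def)

text \<open>The condition is imposed at all lengths, so the scale \<delta> does not enter the
  analysis; lengths below \<delta> are dealt with when the locale is instantiated. There
  \<open>B\<close> is the measure of \<open>A\<close> up to an admissible loss.\<close>

locale frostman_set =
  fixes A :: "real set" and B \<sigma> :: real
  assumes borel [measurable]: "A \<in> sets borel"
    and range: "A \<subseteq> {1..2}"
    and sigma: "1/2 < \<sigma>" "\<sigma> < 1"
    and frostman: "\<And>p q. p < q \<Longrightarrow> measure lborel (A \<inter> {p..q}) \<le> B * (q - p) powr \<sigma>"
begin

abbreviation "\<alpha> \<equiv> measure lborel A"

lemma bounded_A: "bounded A"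
  using range bounded_closed_interval bounded_subset by blast

lemma finite_A: "emeasure lborel A < \<infinity>"
  using emeasure_bounded_finite[OF bounded_A] .

lemma fmeasurable_Int [simp]: "S \<in> sets borel \<Longrightarrow> A \<inter> S \<in> fmeasurable lborel"
  by (rule fmeasurableI2[of A]) (use finite_A in \<open>auto intro!: fmeasurableI\<close>)

lemma integrable_indicator_A [simp]: "integrable lborel (indicator A :: real \<Rightarrow> real)"
  using finite_A by (simp add: integrable_indicator_iff)

lemma integral_indicator_translate: "(\<integral>x. indicator A (x - c) \<partial>lborel) = \<alpha>"
  using lborel_integral_real_affine[of 1 "indicator A :: real \<Rightarrow> real" "-c"] by simp

lemma integrable_indicator_translate: "integrable lborel (\<lambda>x. indicator A (x - c) :: real)"
  using lborel_integrable_real_affine[of "indicator A :: real \<Rightarrow> real" 1 "-c"] by simp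

lemma measure_Int_Icc_add:
  assumes "p \<le> q" "q \<le> r"
  shows "measure lborel (A \<inter> {p..r}) = measure lborel (A \<inter> {p..q}) + measure lborel (A \<inter> {q..r})"
proof -
  have "A \<inter> {p..r} = (A \<inter> {p..q}) \<union> (A \<inter> {q..r})" using assms by auto
  moreover have "measure lborel ((A \<inter> {p..q}) \<union> (A \<inter> {q..r}))
      = measure lborel (A \<inter> {p..q}) + measure lborel (A \<inter> {q..r})"
  proof (rule measure_Un_AE)
    show "AE x in lborel. x \<notin> A \<inter> {p..q} \<or> x \<notin> A \<inter> {q..r}"
      using AE_lborel_singleton[of q] by eventually_elim auto
  qed auto
  ultimately show ?thesis by simp
qed

lemma B_nonneg: "0 \<le> B"
  using order_trans[OF measure_nonneg frostman[of 0 1]] by simp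

lemma integral_Icc_shift_diff:
  "(\<integral>u. indicator {p..q} u * shift_diff A t u \<partial>lborel)
     = measure lborel (A \<inter> {p..q}) - measure lborel (A \<inter> {p-t..q-t})"
proof -
  have 1: "(\<lambda>u. indicator {p..q} u * shift_diff A t u) =
     (\<lambda>u. indicator (A \<inter> {p..q}) u - indicator (A \<inter> {p-t..q-t}) (u - t))"
    by (auto simp: shift_diff_def indicator_def fun_eq_iff)
  have i: "integrable lborel (indicator (A \<inter> {p-t..q-t}) :: real \<Rightarrow> real)"
    "integrable lborel (indicator (A \<inter> {p..q}) :: real \<Rightarrow> real)"
    using fmeasurable_Int by (auto simp: integrable_indicator_iff fmeasurable_def)
  show ?thesis unfolding 1
    using lborel_integral_real_affine[of 1 "indicator (A \<inter> {p-t..q-t}) :: real \<Rightarrow> real" "-t"]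
      lborel_integrable_real_affine[OF i(1), of 1 "-t"] i
    by (subst Bochner_Integration.integral_diff) (auto simp: )
qed

text \<open>The integral is the difference of the masses of \<open>A\<close> in
  \<open>{p..q}\<close> and in the window moved by \<open>t\<close>. Each mass is at most
  \<open>B * (q - p) powr \<sigma>\<close>, which gives one entry of the minimum; cancelling the
  common part leaves end pieces of length \<open>t\<close>, which give the other.\<close>

lemma abs_integral_Icc_shift_diff_le:
  assumes "p < q" "0 < t"
  shows "\<bar>\<integral>u. indicator {p..q} u * shift_diff A t u \<partial>lborel\<bar> \<le> B * (min t (q - p)) powr \<sigma>"
proof -
  define m where "m p q = measure lborel (A \<inter> {p..q})" for p q
  have m: "0 \<le> m p q" for p q by (simp add: m_def)
  have mB: "p < q \<Longrightarrow> m p q \<le> B * (q - p) powr \<sigma>" for p q using frostman by (simp add: m_def)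
  have 1: "\<bar>m p q - m (p-t) (q-t)\<bar> \<le> B * (q - p) powr \<sigma>"
    using m[of p q] m[of "p-t" "q-t"] mB[of p q] mB[of "p-t" "q-t"] assms by simp
  \<comment> \<open>Both sides are the mass in \<open>{p-t..q}\<close>, cut at \<open>p\<close> and
    at \<open>q-t\<close> respectively. This is valid whether or not the two windows
    overlap.\<close>
  have "m (p-t) p + m p q = m (p-t) (q-t) + m (q-t) q"
    using measure_Int_Icc_add[of "p-t" p q] measure_Int_Icc_add[of "p-t" "q-t" q] assms
    by (simp add: m_def)
  then have 2: "\<bar>m p q - m (p-t) (q-t)\<bar> \<le> B * t powr \<sigma>"
    using m[of "p-t" p] m[of "q-t" q] mB[of "p-t" p] mB[of "q-t" q] assms by simp
  show ?thesis unfolding integral_Icc_shift_diff m_def[symmetric] using 1 2 by (simp add: min_def)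
qed

text \<open>As \<open>y\<close> runs over \<open>{1..4}\<close>, the point \<open>v + s * y\<close>
  runs over an interval of length \<open>3 * \<bar>s\<bar>\<close>; the Jacobian accounts for the
  division by \<open>\<bar>s\<bar>\<close>.\<close>

lemma abs_integral_line_shift_diff_le:
  assumes "s \<noteq> 0" "0 < t"
  shows "\<bar>\<integral>y. indicator {1..4} y * shift_diff A t (v + s * y) \<partial>lborel\<bar>
     \<le> B * (min t (3 * \<bar>s\<bar>)) powr \<sigma> / \<bar>s\<bar>"
proof -
  define p q where "p = v + min s (4 * s)" and "q = v + max s (4 * s)"
  have pq: "q - p = 3 * \<bar>s\<bar>" "p < q" using assms by (auto simp: p_def q_def min_def max_def)
  have eq: "indicator {p..q} (v + s * y) = (indicator {1..4} y :: real)" for y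
  proof (cases "s > 0")
    case True
    then have "p \<le> v + s * y \<longleftrightarrow> s * 1 \<le> s * y" "v + s * y \<le> q \<longleftrightarrow> s * y \<le> s * 4"
      by (auto simp: p_def q_def)
    then show ?thesis using True unfolding mult_le_cancel_left_pos[OF True] by (simp add: indicator_def)
  next
    case False
    then have s: "s < 0" using assms by simp
    then have "p \<le> v + s * y \<longleftrightarrow> s * 4 \<le> s * y" "v + s * y \<le> q \<longleftrightarrow> s * y \<le> s * 1"
      by (auto simp: p_def q_def)
    then show ?thesis using s unfolding mult_le_cancel_left_neg[OF s] by (auto simp add: indicator_def)
  qed
  have "(\<integral>u. indicator {p..q} u * shift_diff A t u \<partial>lborel)
     = \<bar>s\<bar> * (\<integral>y. indicator {1..4} y * shift_diff A t (v + s * y) \<partial>lborel)"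
    using lborel_integral_real_affine[OF assms(1), of "\<lambda>u. indicator {p..q} u * shift_diff A t u" v]
    by (simp add: eq)
  then have "\<bar>s\<bar> * \<bar>\<integral>y. indicator {1..4} y * shift_diff A t (v + s * y) \<partial>lborel\<bar>
      \<le> B * (min t (3 * \<bar>s\<bar>)) powr \<sigma>"
    using abs_integral_Icc_shift_diff_le[OF pq(2) assms(2)] pq(1) by (simp add: abs_mult)
  then show ?thesis using assms by (simp add: field_simps)
qed

lemma shift_diff_eq_0: "0 \<le> t \<Longrightarrow> t \<le> 1 \<Longrightarrow> u \<notin> {1..3} \<Longrightarrow> shift_diff A t u = 0"
  using range by (auto simp: shift_diff_def indicator_def)

lemma integrable_shift_diff: "integrable lborel (shift_diff A t)"
  unfolding shift_diff_def[abs_def] using integrable_indicator_A integrable_indicator_translate by simp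

lemma integral_abs_shift_diff_le: "(\<integral>u. \<bar>shift_diff A t u\<bar> \<partial>lborel) \<le> 2 * \<alpha>"
proof -
  have abs_diff_le: "\<bar>indicator A x - indicator A y\<bar> \<le> indicator A x + (indicator A y :: real)" for x y
    by (simp add: indicator_def)
  have "(\<integral>u. \<bar>shift_diff A t u\<bar> \<partial>lborel) \<le> (\<integral>u. indicator A u + indicator A (u - t) \<partial>lborel)"
    using integrable_shift_diff integrable_indicator_A integrable_indicator_translate
    by (intro integral_mono integrable_abs Bochner_Integration.integrable_add)
       (simp_all add: shift_diff_def abs_diff_le)
  also have "\<dots> = 2 * \<alpha>"
    using integrable_indicator_A integrable_indicator_translate integral_indicator_translate
    by (subst Bochner_Integration.integral_add) auto
  finally show ?thesis .
qed

end

section \<open>Bounds for integrals, and Fubini for bounded functions\<close>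

text \<open>A non-integrable \<open>f\<close> has integral 0 by convention, and then the bound holds
  because its right-hand side is nonnegative.\<close>

lemma abs_integral_le_const:
  fixes f :: "'a \<Rightarrow> real"
  assumes "finite_measure M" "0 \<le> c" "AE x in M. \<bar>f x\<bar> \<le> c"
  shows "\<bar>integral\<^sup>L M f\<bar> \<le> c * measure M (space M)"
proof (cases "integrable M f")
  case True
  interpret finite_measure M by fact
  have "\<bar>integral\<^sup>L M f\<bar> \<le> (\<integral>x. \<bar>f x\<bar> \<partial>M)" by (rule integral_abs_bound)
  also have "\<dots> \<le> (\<integral>x. c \<partial>M)" using True assms(3) by (intro integral_mono_AE) auto
  finally show ?thesis by (simp add: mult.commute)
next
  case False
  then show ?thesis using assms(2) by (simp add: not_integrable_integral_eq)
qed

text \<open>The size of the weight \<open>w\<close> is controlled through its nonnegative integral,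
  so \<open>w\<close> may be unbounded. It is applied with the singular kernel
  \<open>\<bar>a - b\<bar> powr (-1/2)\<close>.\<close>

lemma abs_integral_le_nn_integral:
  fixes f w :: "'a \<Rightarrow> real"
  assumes [measurable]: "w \<in> borel_measurable M"
    and k: "0 \<le> k" and C: "0 \<le> C" and f: "AE x in M. \<bar>f x\<bar> \<le> k * w x"
    and w: "(\<integral>\<^sup>+x. ennreal (w x) \<partial>M) \<le> ennreal C"
  shows "\<bar>integral\<^sup>L M f\<bar> \<le> k * C"
proof (cases "integrable M f")
  case True
  have "ennreal \<bar>integral\<^sup>L M f\<bar> \<le> (\<integral>\<^sup>+x. ennreal \<bar>f x\<bar> \<partial>M)"
    using integral_norm_bound_ennreal[OF True] by simp
  also have "\<dots> \<le> (\<integral>\<^sup>+x. ennreal k * ennreal (w x) \<partial>M)"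
    using f by (intro nn_integral_mono_AE) (auto simp: ennreal_mult'[OF k, symmetric] intro: ennreal_leI)
  also have "\<dots> = ennreal k * (\<integral>\<^sup>+x. ennreal (w x) \<partial>M)" by (intro nn_integral_cmult) measurable
  also have "\<dots> \<le> ennreal k * ennreal C" using w by (intro mult_left_mono) auto
  finally show ?thesis using k C by (simp add: ennreal_mult'[symmetric])
next
  case False
  then show ?thesis using k C by (simp add: not_integrable_integral_eq)
qed

lemma Fubini_bounded:
  fixes f :: "'a \<Rightarrow> 'b \<Rightarrow> real"
  assumes M: "finite_measure M" and N: "finite_measure N"
    and f: "(\<lambda>(x, y). f x y) \<in> borel_measurable (M \<Otimes>\<^sub>M N)" and c: "\<And>x y. \<bar>f x y\<bar> \<le> c"
  shows "(\<integral>x. (\<integral>y. f x y \<partial>N) \<partial>M) = (\<integral>y. (\<integral>x. f x y \<partial>M) \<partial>N)"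
    and "(\<integral>z. f (fst z) (snd z) \<partial>(M \<Otimes>\<^sub>M N)) = (\<integral>x. (\<integral>y. f x y \<partial>N) \<partial>M)"
proof -
  interpret M: finite_measure M by fact
  interpret N: finite_measure N by fact
  interpret P: pair_sigma_finite M N ..
  interpret F: finite_measure "M \<Otimes>\<^sub>M N" by (rule finite_measure_pair_measure[OF N M])
  have i: "integrable (M \<Otimes>\<^sub>M N) (\<lambda>(x, y). f x y)"
    by (rule F.integrable_const_bound[of _ c]) (use c f in auto)
  show "(\<integral>x. (\<integral>y. f x y \<partial>N) \<partial>M) = (\<integral>y. (\<integral>x. f x y \<partial>M) \<partial>N)"
    using P.Fubini_integral[OF i] by simp
  show "(\<integral>z. f (fst z) (snd z) \<partial>(M \<Otimes>\<^sub>M N)) = (\<integral>x. (\<integral>y. f x y \<partial>N) \<partial>M)"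
    using P.integral_fst'[OF i] by (simp add: case_prod_unfold)
qed

section \<open>Correlations of translates and the energy of A\<close>

text \<open>The sum of the geometric series \<open>\<Sum>k. 2 powr ((k + 1) / 2) * (2 / 2 ^ k) powr \<sigma>\<close>, which
  comes from cutting the kernel \<open>\<bar>a - b\<bar> powr (-1/2)\<close> into dyadic pieces; it converges because
  \<open>\<sigma> > 1/2\<close>.\<close>

definition riesz_const :: "real \<Rightarrow> real" where
  "riesz_const \<sigma> = 2 powr (\<sigma> + 1/2) / (1 - 2 powr (1/2 - \<sigma>))"

lemma riesz_const_pos:
  assumes "1/2 < \<sigma>"
  shows "0 < riesz_const \<sigma>"
proof -
  have "2 powr (1/2 - \<sigma>) < 2 powr (0::real)" using assms by (intro powr_less_mono) auto
  then show ?thesis by (simp add: riesz_const_def)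
qed

context frostman_set
begin

text \<open>With \<open>m\<close> the minimum, split \<open>m powr \<sigma>\<close> into exponents
  \<sigma> - 1/2 and 1/2, and use \<open>m \<le> t\<close> in the first factor and
  \<open>m \<le> 3 * s\<close> in the second. The power of \<open>t\<close> provides smallness, and
  the singularity left in \<open>s\<close> is mild enough to have finite energy. The constant 2
  replaces \<open>sqrt 3\<close>.\<close>

lemma min_powr_divide_le:
  assumes "0 < t" "0 < s"
  shows "(min t (3 * s)) powr \<sigma> / s \<le> 2 * t powr (\<sigma> - 1/2) * s powr (-1/2)"
proof -
  define m where "m = min t (3 * s)"
  have m: "0 < m" "m \<le> t" "m \<le> 3 * s" using assms by (auto simp: m_def)
  have "m powr \<sigma> = m powr (\<sigma> - 1/2) * m powr (1/2)" by (simp flip: powr_add)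
  also have "\<dots> \<le> t powr (\<sigma> - 1/2) * (3 * s) powr (1/2)"
    using m sigma by (intro mult_mono powr_mono2) auto
  also have "(3 * s) powr (1/2) = sqrt 3 * s powr (1/2)"
    using assms by (simp add: powr_mult powr_half_sqrt)
  also have "t powr (\<sigma> - 1/2) * (sqrt 3 * s powr (1/2)) \<le> t powr (\<sigma> - 1/2) * (2 * s powr (1/2))"
    by (intro mult_left_mono mult_right_mono) (auto intro: real_le_lsqrt)
  finally have "m powr \<sigma> / s \<le> t powr (\<sigma> - 1/2) * (2 * s powr (1/2)) / s"
    using assms by (intro divide_right_mono) auto
  also have "s powr (1/2) / s = s powr (-1/2)"
    using assms powr_diff[of s "1/2" 1] by simp
  then have "t powr (\<sigma> - 1/2) * (2 * s powr (1/2)) / s = 2 * t powr (\<sigma> - 1/2) * s powr (-1/2)"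
    by (metis (no_types, opaque_lifting) mult.assoc mult.commute times_divide_eq_right)
  finally show ?thesis by (simp add: m_def)
qed

text \<open>The constant 8 is a product of three factors 2: one from
  \<open>min_powr_divide_le\<close>, one from
  \<open>\<bar>s\<bar> \<ge> \<bar>a - b\<bar> / 4\<close> raised to the power -1/2, and one from
  the L1 norm of \<open>g\<close>, which is at most 2\<alpha>.\<close>

lemma abs_correlation_le:
  assumes ab: "a \<in> {1..2}" "b \<in> {1..2}" "a \<noteq> b" and t: "0 < t" "t \<le> 1"
  shows "\<bar>\<integral>y. (\<integral>x. shift_diff A t (x - y / a) * shift_diff A t (x - y / b) \<partial>leb_on {0..8}) \<partial>leb_on {1..4}\<bar>
     \<le> 8 * \<alpha> * B * t powr (\<sigma> - 1/2) * \<bar>a - b\<bar> powr (-1/2)"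
proof -
  define g where "g = shift_diff A t"
  have [measurable]: "g \<in> borel_measurable borel" by (simp add: g_def)
  have g1: "\<bar>g u\<bar> \<le> 1" for u unfolding g_def by (rule abs_shift_diff_le_1)
  have g0: "u \<notin> {1..3} \<Longrightarrow> g u = 0" for u using shift_diff_eq_0 t by (simp add: g_def)
  define s where "s = 1 / a - 1 / b"
  define Q where "Q = B * (min t (3 * \<bar>s\<bar>)) powr \<sigma> / \<bar>s\<bar>"
  have s: "\<bar>s\<bar> = \<bar>a - b\<bar> / (a * b)"
    using ab by (auto simp: s_def abs_if field_simps)
  have Q0: "0 \<le> Q" using B_nonneg by (simp add: Q_def)
  have fm: "finite_measure (leb_on {0..8})" "finite_measure (leb_on {1..4})"
    by (auto intro: finite_measure_leb_on)
  have inner: "(\<integral>x. g (x - y / a) * g (x - y / b) \<partial>leb_on {0..8})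
      = (\<integral>u. g u * g (u + s * y) \<partial>leb_on {0..8})" if "y \<in> {1..4}" for y
  proof -
    have ya: "0 \<le> y / a" "y / a \<le> 4" using that ab by (auto simp: field_simps)
    have "(\<integral>x. g (x - y / a) * g (x - y / b) \<partial>leb_on {0..8})
        = (\<integral>x. indicator {0..8} x * (g (x - y / a) * g (x - y / b)) \<partial>lborel)"
      by (subst integral_leb_on) auto
    \<comment> \<open>Since \<open>g\<close> vanishes off \<open>{1..3}\<close> and
      \<open>y / a\<close> lies in \<open>{0..4}\<close>, the integrand lives on
      \<open>{1..7}\<close>. Dropping the cutoff makes the translation by \<open>y / a\<close>
      possible; it is restored afterwards to have finite measures for Fubini.\<close>
    also have "\<dots> = (\<integral>x. g (x - y / a) * g (x - y / b) \<partial>lborel)"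
    proof (rule Bochner_Integration.integral_cong)
      fix x show "indicator {0..8} x * (g (x - y / a) * g (x - y / b)) = g (x - y / a) * g (x - y / b)"
        using g0[of "x - y / a"] ya by (cases "x \<in> {0..8}") auto
    qed simp
    also have "\<dots> = (\<integral>u. g u * g (u + s * y) \<partial>lborel)"
      using lborel_integral_real_affine[of 1 "\<lambda>x. g (x - y / a) * g (x - y / b)" "y / a"]
      by (simp add: s_def algebra_simps)
    also have "\<dots> = (\<integral>u. indicator {0..8} u * (g u * g (u + s * y)) \<partial>lborel)"
    proof (rule Bochner_Integration.integral_cong)
      fix u show "g u * g (u + s * y) = indicator {0..8} u * (g u * g (u + s * y))"
        using g0[of u] by (cases "u \<in> {0..8}") auto
    qed simp
    also have "\<dots> = (\<integral>u. g u * g (u + s * y) \<partial>leb_on {0..8})"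
      by (subst integral_leb_on) auto
    finally show ?thesis .
  qed
  \<comment> \<open>Integrating in \<open>y\<close> first exploits the cancellation in \<open>g\<close>.\<close>
  have "(\<integral>y. (\<integral>x. g (x - y / a) * g (x - y / b) \<partial>leb_on {0..8}) \<partial>leb_on {1..4})
     = (\<integral>y. (\<integral>u. g u * g (u + s * y) \<partial>leb_on {0..8}) \<partial>leb_on {1..4})"
  proof (rule integral_cong_AE)
    interpret sigma_finite_measure "leb_on {0..8}" using fm(1) finite_measure.axioms by blast
    show "(\<lambda>y. \<integral>x. g (x - y / a) * g (x - y / b) \<partial>leb_on {0..8}) \<in> borel_measurable (leb_on {1..4})"
      "(\<lambda>y. \<integral>u. g u * g (u + s * y) \<partial>leb_on {0..8}) \<in> borel_measurable (leb_on {1..4})"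
      by measurable
  qed (use inner in \<open>auto intro!: AE_leb_on\<close>)
  also have "\<dots> = (\<integral>u. (\<integral>y. g u * g (u + s * y) \<partial>leb_on {1..4}) \<partial>leb_on {0..8})"
  proof (rule Fubini_bounded(1)[OF fm(2,1)])
    show "(\<lambda>(y, u). g u * g (u + s * y)) \<in> borel_measurable (leb_on {1..4} \<Otimes>\<^sub>M leb_on {0..8})"
      by measurable
    show "\<bar>g u * g (u + s * y)\<bar> \<le> 1" for y u
      using g1 by (simp add: abs_mult mult_le_one)
  qed
  also have "\<bar>\<dots>\<bar> \<le> Q * (2 * \<alpha>)"
  proof (rule abs_integral_le_nn_integral)
    show "(\<lambda>u. \<bar>g u\<bar>) \<in> borel_measurable (leb_on {0..8})" by measurable
    show "AE u in leb_on {0..8}. \<bar>\<integral>y. g u * g (u + s * y) \<partial>leb_on {1..4}\<bar> \<le> Q * \<bar>g u\<bar>"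
    proof (rule AE_I2)
      fix u
      have "\<bar>\<integral>y. g (u + s * y) \<partial>leb_on {1..4}\<bar> \<le> Q"
        unfolding Q_def g_def using abs_integral_line_shift_diff_le[of s t u] t ab
        by (subst integral_leb_on) (auto simp: s_def)
      then have "\<bar>g u\<bar> * \<bar>\<integral>y. g (u + s * y) \<partial>leb_on {1..4}\<bar> \<le> \<bar>g u\<bar> * Q"
        by (intro mult_left_mono) auto
      then show "\<bar>\<integral>y. g u * g (u + s * y) \<partial>leb_on {1..4}\<bar> \<le> Q * \<bar>g u\<bar>"
        by (simp add: abs_mult mult.commute)
    qed
    have "(\<integral>\<^sup>+u. ennreal \<bar>g u\<bar> \<partial>leb_on {0..8}) = (\<integral>\<^sup>+u. indicator {0..8} u * ennreal \<bar>g u\<bar> \<partial>lborel)"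
      by (rule nn_integral_leb_on) auto
    also have "\<dots> \<le> (\<integral>\<^sup>+u. ennreal \<bar>g u\<bar> \<partial>lborel)"
      by (intro nn_integral_mono) (auto simp: indicator_def)
    also have "\<dots> = ennreal (\<integral>u. \<bar>g u\<bar> \<partial>lborel)"
      using integrable_shift_diff by (intro nn_integral_eq_integral) (auto simp: g_def)
    also have "\<dots> \<le> ennreal (2 * \<alpha>)"
      using integral_abs_shift_diff_le by (intro ennreal_leI) (simp add: g_def)
    finally show "(\<integral>\<^sup>+u. ennreal \<bar>g u\<bar> \<partial>leb_on {0..8}) \<le> ennreal (2 * \<alpha>)" .
  qed (use Q0 in auto)
  also have "Q \<le> B * (4 * t powr (\<sigma> - 1/2) * \<bar>a - b\<bar> powr (-1/2))"
  proof -
    have s0: "0 < \<bar>s\<bar>" using ab by (auto simp: s)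
    have "a * b \<le> 2 * 2" using ab by (intro mult_mono) auto
    then have "\<bar>a - b\<bar> / 4 \<le> \<bar>s\<bar>" unfolding s using ab by (intro divide_left_mono) auto
    then have "\<bar>s\<bar> powr (-1/2) \<le> (\<bar>a - b\<bar> / 4) powr (-1/2)"
      using ab by (intro powr_mono2') auto
    also have "\<dots> = 2 * \<bar>a - b\<bar> powr (-1/2)"
      by (simp add: powr_divide powr_minus powr_half_sqrt inverse_eq_divide)
    finally have 1: "\<bar>s\<bar> powr (-1/2) \<le> 2 * \<bar>a - b\<bar> powr (-1/2)" .
    have "(min t (3 * \<bar>s\<bar>)) powr \<sigma> / \<bar>s\<bar> \<le> 2 * t powr (\<sigma> - 1/2) * \<bar>s\<bar> powr (-1/2)"
      using min_powr_divide_le[OF t(1) s0] .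
    also have "\<dots> \<le> 2 * t powr (\<sigma> - 1/2) * (2 * \<bar>a - b\<bar> powr (-1/2))"
      using 1 by (intro mult_left_mono) auto
    finally have "B * ((min t (3 * \<bar>s\<bar>)) powr \<sigma> / \<bar>s\<bar>) \<le> B * (2 * t powr (\<sigma> - 1/2) * (2 * \<bar>a - b\<bar> powr (-1/2)))"
      by (rule mult_left_mono[OF _ B_nonneg])
    then show ?thesis unfolding Q_def by (simp add: mult_ac)
  qed
  then have "Q * (2 * \<alpha>) \<le> B * (4 * t powr (\<sigma> - 1/2) * \<bar>a - b\<bar> powr (-1/2)) * (2 * \<alpha>)"
    by (intro mult_right_mono) auto
  finally show ?thesis by (simp add: g_def mult_ac)
qed

text \<open>At distance between 2^(-k-1) and 2^(-k) from \<open>b\<close> the kernel is at most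
  \<open>c k\<close>, while \<open>I k\<close> has length 2 * 2^(-k), so the Frostman condition
  bounds its mass. The result is a geometric series with ratio
  \<open>2 powr (1/2 - \<sigma>)\<close>.\<close>

lemma riesz_energy_bound:
  assumes b: "b \<in> {1..2}"
  shows "(\<integral>\<^sup>+a. ennreal (\<bar>a - b\<bar> powr (-1/2)) \<partial>leb_on A) \<le> ennreal (riesz_const \<sigma> * B)"
proof -
  define I where "I k = {b - (1/2)^k..b + (1/2::real)^k}" for k :: nat
  define c where "c k = (2::real) powr ((real k + 1) / 2)" for k :: nat
  have [measurable]: "I k \<in> sets borel" for k by (simp add: I_def)
  have term_le: "f k \<le> (\<Sum>k. f k)" for f :: "nat \<Rightarrow> ennreal" and k
    using sum_le_suminf[of f "{k}"] by simp
  have "(\<integral>\<^sup>+a. ennreal (\<bar>a - b\<bar> powr (-1/2)) \<partial>leb_on A)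
      \<le> (\<integral>\<^sup>+a. (\<Sum>k. ennreal (c k) * indicator (I k) a) \<partial>leb_on A)"
  proof (rule nn_integral_mono_AE, rule AE_leb_on[OF borel])
    fix a assume "a \<in> A"
    show "ennreal (\<bar>a - b\<bar> powr (-1/2)) \<le> (\<Sum>k. ennreal (c k) * indicator (I k) a)"
    \<comment> \<open>At \<open>a = b\<close> the left-hand side is 0, because
      \<open>0 powr x = 0\<close>.\<close>
    proof (cases "a = b")
      case False
      define d where "d = \<bar>a - b\<bar>"
      have d: "0 < d" "d \<le> 1" using False subsetD[OF range \<open>a \<in> A\<close>] b by (auto simp: d_def)
      obtain n where n: "(1/2::real) ^ n < d" using real_arch_pow_inv[of d "1/2"] d by auto
      \<comment> \<open>\<open>m\<close> is the first exponent with 2^(-m) < d. As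
        \<open>d \<le> 1\<close>, it is not 0, and minimality gives d <= 2^(-k) for its predecessor
        \<open>k\<close>; this locates \<open>d\<close> in one dyadic shell.\<close>
      define m where "m = (LEAST n. (1/2::real) ^ n < d)"
      have m: "(1/2::real) ^ m < d" unfolding m_def using n by (rule LeastI)
      then obtain k where k: "m = Suc k" using d by (cases m) auto
      have "\<not> (1/2::real) ^ k < d" using not_less_Least[of k "\<lambda>n. (1/2::real) ^ n < d"] k
        by (simp add: m_def)
      then have "a \<in> I k" by (auto simp: I_def d_def abs_if split: if_splits)
      have "(2::real) powr (- (real k + 1)) = (1/2) ^ m"
        by (simp only: k powr_minus powr_realpow' of_nat_Suc[symmetric] add.commute)
           (simp add: powr_realpow power_one_over powr_minus inverse_eq_divide)
      then have "d powr (-1/2) \<le> (2 powr (- (real k + 1))) powr (-1/2)"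
        using d m by (intro powr_mono2') auto
      also have "\<dots> = c k" by (simp add: powr_powr c_def diff_divide_distrib add_divide_distrib add.commute)
      finally have "ennreal (\<bar>a - b\<bar> powr (-1/2)) \<le> ennreal (c k) * indicator (I k) a"
        using \<open>a \<in> I k\<close> by (simp add: d_def ennreal_leI)
      also have "\<dots> \<le> (\<Sum>k. ennreal (c k) * indicator (I k) a)"
        by (rule term_le)
      finally show ?thesis .
    qed simp
  qed
  also have "\<dots> = (\<Sum>k. (\<integral>\<^sup>+a. ennreal (c k) * indicator (I k) a \<partial>leb_on A))"
    by (intro nn_integral_suminf) measurable
  also have "\<dots> \<le> (\<Sum>k. ennreal (B * 2 powr (\<sigma> + 1/2) * (2 powr (1/2 - \<sigma>)) ^ k))"
  proof (intro suminf_le summableI)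
    fix k
    have "(\<integral>\<^sup>+a. ennreal (c k) * indicator (I k) a \<partial>leb_on A) = ennreal (c k) * (\<integral>\<^sup>+a. indicator (I k) a \<partial>leb_on A)"
      by (rule nn_integral_cmult) measurable
    also have "(\<integral>\<^sup>+a. indicator (I k) a \<partial>leb_on A) = (\<integral>\<^sup>+a. indicator A a * indicator (I k) a \<partial>lborel)"
      by (rule nn_integral_leb_on) auto
    also have "\<dots> = (\<integral>\<^sup>+a. indicator (A \<inter> I k) a \<partial>lborel)"
      by (simp only: indicator_inter_arith)
    also have "\<dots> = ennreal (measure lborel (A \<inter> I k))"
      using fmeasurable_Int[of "I k"] by (simp add: emeasure_eq_measure2 del: fmeasurable_Int)
    also have "ennreal (c k) * \<dots> \<le> ennreal (c k) * ennreal (B * (2 * (1/2)^k) powr \<sigma>)"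
      using frostman[of "b - (1/2)^k" "b + (1/2)^k"]
      by (intro mult_left_mono ennreal_leI) (auto simp: I_def)
    also have "\<dots> = ennreal (c k * (B * (2 * (1/2)^k) powr \<sigma>))"
      using B_nonneg by (intro ennreal_mult'[symmetric]) (simp add: c_def)
    also have "c k * (B * (2 * (1/2)^k) powr \<sigma>) = B * 2 powr (\<sigma> + 1/2) * (2 powr (1/2 - \<sigma>)) ^ k"
    proof -
      have "(2 * (1/2)^k :: real) = 2 powr (1 - real k)"
        by (simp add: powr_diff powr_realpow power_one_over)
      moreover have "(2 powr (1/2 - \<sigma>)) ^ k = 2 powr ((1/2 - \<sigma>) * real k)"
        by (simp add: powr_realpow[symmetric] powr_powr)
      moreover have "c k * 2 powr ((1 - real k) * \<sigma>) = 2 powr (\<sigma> + 1/2) * 2 powr ((1/2 - \<sigma>) * real k)"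
        by (simp add: c_def powr_add[symmetric]) (simp add: algebra_simps add_divide_distrib)
      ultimately show ?thesis by (simp add: powr_powr mult_ac)
    qed
    finally show "(\<integral>\<^sup>+a. ennreal (c k) * indicator (I k) a \<partial>leb_on A)
      \<le> ennreal (B * 2 powr (\<sigma> + 1/2) * (2 powr (1/2 - \<sigma>)) ^ k)" .
  qed
  also have "\<dots> = ennreal (\<Sum>k. B * 2 powr (\<sigma> + 1/2) * (2 powr (1/2 - \<sigma>)) ^ k)"
  proof (rule suminf_ennreal2)
    show "summable (\<lambda>k. B * 2 powr (\<sigma> + 1/2) * (2 powr (1/2 - \<sigma>)) ^ k)"
      using sigma powr_less_mono[of "1/2 - \<sigma>" 0 2] by (intro summable_mult summable_geometric) auto
  qed (use B_nonneg in auto)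
  also have "(\<Sum>k. B * 2 powr (\<sigma> + 1/2) * (2 powr (1/2 - \<sigma>)) ^ k) = riesz_const \<sigma> * B"
    using sigma powr_less_mono[of "1/2 - \<sigma>" 0 2]
    by (subst suminf_mult) (auto simp: suminf_geometric riesz_const_def intro!: summable_geometric)
  finally show ?thesis .
qed

end

section \<open>The L2 bound for averaged differences\<close>

text \<open>The first coordinate is the product variable y, the second the sum variable x. The
  window \<open>{0..8}\<close> is larger than the range of the sums so that it also holds the
  support of each x \<mapsto> \<open>shift_diff A t (x - y / a)\<close>.\<close>

abbreviation leb_box :: "(real \<times> real) measure" where
  "leb_box \<equiv> leb_on {1..4} \<Otimes>\<^sub>M leb_on {0..8}"

lemma finite_measure_leb_box: "finite_measure leb_box"
  by (intro finite_measure_pair_measure finite_measure_leb_on) auto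

lemma finite_measure_measurable_integral:
  fixes f :: "'a \<Rightarrow> 'b \<Rightarrow> real"
  assumes "finite_measure N" "(\<lambda>(x, y). f x y) \<in> borel_measurable (M \<Otimes>\<^sub>M N)"
  shows "(\<lambda>x. \<integral>y. f x y \<partial>N) \<in> borel_measurable M"
proof -
  interpret sigma_finite_measure N using assms(1) finite_measure.axioms by blast
  show ?thesis using borel_measurable_lebesgue_integral[OF assms(2)] .
qed

context frostman_set
begin

lemma finite_measure_A: "finite_measure (leb_on A)"
  using borel bounded_A by (rule finite_measure_leb_on)

lemma abs_integral_A_le:
  assumes "0 \<le> c" "\<And>x. x \<in> A \<Longrightarrow> \<bar>f x\<bar> \<le> c"
  shows "\<bar>\<integral>x. f x \<partial>leb_on A\<bar> \<le> c * \<alpha>"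
  using abs_integral_le_const[OF finite_measure_A assms(1) AE_leb_on[OF borel assms(2)]]
  by (simp add: measure_leb_on_UNIV)

text \<open>Integrated over P, this function gives T(0) - T(t); its L2 norm is therefore what
  Cauchy-Schwarz calls for.\<close>

definition avg_diff :: "real \<Rightarrow> real \<times> real \<Rightarrow> real" where
  "avg_diff t w = (\<integral>a. shift_diff A t (snd w - fst w / a) \<partial>leb_on A)"

lemma avg_diff_measurable [measurable]: "avg_diff t \<in> borel_measurable leb_box"
  unfolding avg_diff_def[abs_def]
  by (rule finite_measure_measurable_integral[OF finite_measure_A]) measurable

lemma abs_avg_diff_le: "\<bar>avg_diff t w\<bar> \<le> \<alpha>"
  unfolding avg_diff_def using abs_integral_A_le[of 1 "\<lambda>a. shift_diff A t (snd w - fst w / a)"]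
  by (simp add: abs_shift_diff_le_1)

text \<open>Expanding the square and exchanging integrals yields a double integral over pairs
  \<open>a\<close>, \<open>b\<close> in \<open>A\<close> of the correlations bounded above. The
  integral over \<open>b\<close> is an energy, and the one over \<open>a\<close> contributes another
  factor \<alpha>.\<close>

lemma integral_avg_diff_square_le:
  assumes t: "0 < t" "t \<le> 1"
  shows "(\<integral>w. (avg_diff t w)\<^sup>2 \<partial>leb_box)
     \<le> 8 * riesz_const \<sigma> * \<alpha>\<^sup>2 * B\<^sup>2 * t powr (\<sigma> - 1/2)"
proof -
  define g where "g w a = shift_diff A t (snd w - fst w / a)" for w :: "real \<times> real" and a
  have [measurable]: "(\<lambda>(w, a). g w a) \<in> borel_measurable (leb_box \<Otimes>\<^sub>M leb_on A)"
    "g w \<in> borel_measurable borel" "(\<lambda>w. g w a) \<in> borel_measurable leb_box" for w a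
    unfolding g_def by measurable
  have g1: "\<bar>g w a\<bar> \<le> 1" for w a unfolding g_def by (rule abs_shift_diff_le_1)
  have G: "avg_diff t w = (\<integral>a. g w a \<partial>leb_on A)" for w by (simp add: avg_diff_def g_def)
  have "(\<integral>w. (avg_diff t w)\<^sup>2 \<partial>leb_box) = (\<integral>w. (\<integral>a. g w a * avg_diff t w \<partial>leb_on A) \<partial>leb_box)"
    by (simp add: power2_eq_square G)
  also have "\<dots> = (\<integral>a. (\<integral>w. g w a * avg_diff t w \<partial>leb_box) \<partial>leb_on A)"
  proof (rule Fubini_bounded(1)[OF finite_measure_leb_box finite_measure_A, where c = \<alpha>])
    show "(\<lambda>(w, a). g w a * avg_diff t w) \<in> borel_measurable (leb_box \<Otimes>\<^sub>M leb_on A)"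
      by measurable
    show "\<bar>g w a * avg_diff t w\<bar> \<le> \<alpha>" for w a
      using mult_mono[OF g1[of w a] abs_avg_diff_le[of t w]] by (simp add: abs_mult)
  qed
  also have "\<dots> = (\<integral>a. (\<integral>b. (\<integral>w. g w a * g w b \<partial>leb_box) \<partial>leb_on A) \<partial>leb_on A)"
  proof (rule Bochner_Integration.integral_cong)
    fix a
    have "(\<integral>w. g w a * avg_diff t w \<partial>leb_box) = (\<integral>w. (\<integral>b. g w a * g w b \<partial>leb_on A) \<partial>leb_box)"
      by (simp add: G)
    also have "\<dots> = (\<integral>b. (\<integral>w. g w a * g w b \<partial>leb_box) \<partial>leb_on A)"
    proof (rule Fubini_bounded(1)[OF finite_measure_leb_box finite_measure_A, where c = 1])
      show "(\<lambda>(w, b). g w a * g w b) \<in> borel_measurable (leb_box \<Otimes>\<^sub>M leb_on A)"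
        by measurable
      show "\<bar>g w a * g w b\<bar> \<le> 1" for w b
        using mult_mono[OF g1[of w a] g1[of w b]] by (simp add: abs_mult)
    qed
    finally show "(\<integral>w. g w a * avg_diff t w \<partial>leb_box) = (\<integral>b. (\<integral>w. g w a * g w b \<partial>leb_box) \<partial>leb_on A)" .
  qed simp
  also have "\<bar>\<dots>\<bar> \<le> (8 * \<alpha> * B * t powr (\<sigma> - 1/2)) * (riesz_const \<sigma> * B) * \<alpha>"
  proof (rule abs_integral_A_le)
    fix a assume "a \<in> A"
    then have a: "a \<in> {1..2}" using range by blast
    show "\<bar>\<integral>b. (\<integral>w. g w a * g w b \<partial>leb_box) \<partial>leb_on A\<bar> \<le> (8 * \<alpha> * B * t powr (\<sigma> - 1/2)) * (riesz_const \<sigma> * B)"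
    proof (rule abs_integral_le_nn_integral[OF _ _ _ _ riesz_energy_bound[OF a]])
      \<comment> \<open>The correlation bound is available only off the diagonal, which for fixed
        \<open>a\<close> is a null set in \<open>b\<close>.\<close>
      have "AE b in leb_on A. b \<in> A" by (rule AE_leb_on) auto
      with AE_leb_on_neq[OF borel, of a]
      show "AE b in leb_on A. \<bar>\<integral>w. g w a * g w b \<partial>leb_box\<bar> \<le> 8 * \<alpha> * B * t powr (\<sigma> - 1/2) * \<bar>b - a\<bar> powr (-1/2)"
      proof eventually_elim
        case (elim b)
        have b: "b \<in> {1..2}" "a \<noteq> b" using elim range by auto
        have "(\<integral>w. g w a * g w b \<partial>leb_box) = (\<integral>w. (\<lambda>y x. shift_diff A t (x - y / a) * shift_diff A t (x - y / b)) (fst w) (snd w) \<partial>leb_box)"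
          by (simp add: g_def)
        also have "\<dots> = (\<integral>y. (\<integral>x. shift_diff A t (x - y / a) * shift_diff A t (x - y / b) \<partial>leb_on {0..8}) \<partial>leb_on {1..4})"
        proof (rule Fubini_bounded(2)[where c = 1])
          show "(\<lambda>(y, x). shift_diff A t (x - y / a) * shift_diff A t (x - y / b)) \<in> borel_measurable leb_box"
            by measurable
          show "\<bar>shift_diff A t (x - y / a) * shift_diff A t (x - y / b)\<bar> \<le> 1" for x y
            using mult_mono[OF abs_shift_diff_le_1[of A t "x - y / a"] abs_shift_diff_le_1[of A t "x - y / b"]]
            by (simp add: abs_mult)
        qed (auto intro: finite_measure_leb_on)
        finally show ?case
          using abs_correlation_le[OF a b(1) b(2) t] by (simp add: abs_minus_commute)
      qed
    qed (use B_nonneg riesz_const_pos[OF sigma(1)] in auto)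
  qed (use B_nonneg riesz_const_pos[OF sigma(1)] in auto)
  finally show ?thesis by (simp add: power2_eq_square mult_ac)
qed

section \<open>Counting incidences with the grid of products and sums\<close>

context
  fixes X Y :: "real set"
  assumes X [measurable]: "X \<in> sets borel" and Y [measurable]: "Y \<in> sets borel"
    and X_sub: "X \<subseteq> {0..8}" and Y_sub: "Y \<subseteq> {1..4}"
    and sum_in_X: "\<And>a b. a \<in> A \<Longrightarrow> b \<in> A \<Longrightarrow> a + b \<in> X"
    and prod_in_Y: "\<And>a b. a \<in> A \<Longrightarrow> b \<in> A \<Longrightarrow> a * b \<in> Y"
begin

text \<open>The indicator of the rectangle P, with \<open>Y\<close> and \<open>X\<close> in the
  roles of AA and A+A; of these sets only Borel measurability, their ranges and the two closure
  properties are retained.\<close>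

definition grid :: "real \<times> real \<Rightarrow> real" where
  "grid w = indicator Y (fst w) * indicator X (snd w)"

text \<open>The count T(t), with the integral over \<open>a\<close> innermost so that differences in
  \<open>t\<close> are integrals of \<open>grid\<close> against \<open>avg_diff\<close>.\<close>

definition incidences :: "real \<Rightarrow> real" where
  "incidences t = (\<integral>w. grid w * (\<integral>a. indicator A (snd w - t - fst w / a) \<partial>leb_on A) \<partial>leb_box)"

lemma grid_measurable [measurable]: "grid \<in> borel_measurable leb_box"
  unfolding grid_def[abs_def] by measurable

lemma grid_01: "0 \<le> grid w" "grid w \<le> 1"
  by (auto simp: grid_def indicator_def)

lemma abs_indicator_integral_A_le: "\<bar>\<integral>a. indicator A (u a) \<partial>leb_on A\<bar> \<le> \<alpha>"
  using abs_integral_A_le[of 1 "\<lambda>a. indicator A (u a)"] by simp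

lemma measure_X_Y: "measure lborel X * measure lborel Y = (\<integral>w. grid w \<partial>leb_box)"
proof -
  have "(\<integral>w. grid w \<partial>leb_box) = (\<integral>w. (\<lambda>y x. indicator Y y * indicator X x) (fst w) (snd w) \<partial>leb_box)"
    by (simp add: grid_def[abs_def])
  also have "\<dots> = (\<integral>y. (\<integral>x. indicator Y y * indicator X x \<partial>leb_on {0..8}) \<partial>leb_on {1..4})"
    by (rule Fubini_bounded(2)[where c = 1]) (auto intro: finite_measure_leb_on simp: indicator_def)
  also have "\<dots> = (\<integral>y. indicator Y y * measure lborel X \<partial>leb_on {1..4})"
  proof -
    have "(\<integral>x. indicator X x \<partial>leb_on {0..8}) = measure lborel X"
      using X_sub by (subst integral_leb_on) (auto simp: indicator_inter_arith[symmetric] Int_absorb1)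
    then show ?thesis by simp
  qed
  also have "\<dots> = measure lborel Y * measure lborel X"
    using Y_sub by (subst integral_leb_on)
      (auto simp: indicator_inter_arith[symmetric] Int_absorb1 mult.assoc[symmetric])
  finally show ?thesis by simp
qed

text \<open>Fix \<open>a\<close> in \<open>A\<close>. If \<open>b = y / a\<close> is in
  \<open>A\<close>, then \<open>y = a * b\<close> is in \<open>Y\<close> and every
  \<open>b + c\<close> with \<open>c\<close> in \<open>A\<close> is in \<open>X\<close>, so the
  fibre over \<open>y\<close> has mass \<alpha>. These \<open>y\<close> form the dilate of
  \<open>A\<close> by \<open>a\<close>, of measure \<open>a * \<alpha>\<close>.\<close>

lemma incidences_0_ge: "\<alpha> ^ 3 \<le> incidences 0"
proof -
  define F where "F w a = grid w * indicator A (snd w - fst w / a)" for w a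
  have F01: "0 \<le> F w a" "F w a \<le> 1" for w a by (auto simp: F_def grid_def indicator_def)
  have F_meas [measurable]: "(\<lambda>(w, a). F w a) \<in> borel_measurable (leb_box \<Otimes>\<^sub>M leb_on A)"
    unfolding F_def by measurable
  have "incidences 0 = (\<integral>w. (\<integral>a. F w a \<partial>leb_on A) \<partial>leb_box)"
    by (simp add: incidences_def F_def)
  also have "\<dots> = (\<integral>a. (\<integral>w. F w a \<partial>leb_box) \<partial>leb_on A)"
    by (rule Fubini_bounded(1)[OF finite_measure_leb_box finite_measure_A F_meas, where c = 1])
       (use F01 in auto)
  also have "\<dots> \<ge> (\<integral>a. \<alpha>\<^sup>2 \<partial>leb_on A)"
  proof (rule integral_mono_AE)
    interpret A: finite_measure "leb_on A" by (rule finite_measure_A)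
    show "integrable (leb_on A) (\<lambda>a. \<alpha>\<^sup>2)" by simp
    have "\<bar>\<integral>w. F w a \<partial>leb_box\<bar> \<le> 1 * measure leb_box (space leb_box)" for a
      by (rule abs_integral_le_const[OF finite_measure_leb_box]) (use F01 in auto)
    moreover have "(\<lambda>a. \<integral>w. F w a \<partial>leb_box) \<in> borel_measurable (leb_on A)"
      by (rule finite_measure_measurable_integral[OF finite_measure_leb_box]) measurable
    ultimately show "integrable (leb_on A) (\<lambda>a. \<integral>w. F w a \<partial>leb_box)"
      by (intro A.integrable_const_bound[where B = "measure leb_box (space leb_box)"]) auto
    show "AE a in leb_on A. \<alpha>\<^sup>2 \<le> (\<integral>w. F w a \<partial>leb_box)"
    proof (rule AE_leb_on)
      fix a assume "a \<in> A"
      then have a: "1 \<le> a" "a \<le> 2" using range by auto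
      define H where "H y = (\<integral>x. F (y, x) a \<partial>leb_on {0..8})" for y
      have FH: "(\<integral>w. F w a \<partial>leb_box) = (\<integral>y. H y \<partial>leb_on {1..4})"
      proof -
        have "(\<integral>w. F w a \<partial>leb_box) = (\<integral>w. (\<lambda>y x. F (y, x) a) (fst w) (snd w) \<partial>leb_box)" by simp
        also have "\<dots> = (\<integral>y. H y \<partial>leb_on {1..4})" unfolding H_def
        proof (rule Fubini_bounded(2)[where c = 1])
          show "(\<lambda>(y, x). F (y, x) a) \<in> borel_measurable leb_box"
            unfolding F_def grid_def by measurable
        qed (use F01 in \<open>auto intro: finite_measure_leb_on\<close>)
        finally show ?thesis .
      qed
      have H0: "0 \<le> H y" for y unfolding H_def using F01 by simp
      have H_eq: "H y = \<alpha>" if "y / a \<in> A" for y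
      proof -
        have "y = a * (y / a)" using a by simp
        then have yY: "y \<in> Y" using prod_in_Y[OF \<open>a \<in> A\<close> that] by simp
        have "H y = (\<integral>x. indicator {0..8} x * F (y, x) a \<partial>lborel)"
          unfolding H_def by (subst integral_leb_on) (auto simp: F_def grid_def)
        also have "\<dots> = (\<integral>x. indicator A (x - y / a) \<partial>lborel)"
        proof (rule Bochner_Integration.integral_cong)
          fix x
          have "x \<in> X" if "x - y / a \<in> A" using sum_in_X[OF that \<open>y / a \<in> A\<close>] by simp
          then show "indicator {0..8} x * F (y, x) a = indicator A (x - y / a)"
            using yY X_sub by (auto simp: F_def grid_def indicator_def)
        qed simp
        also have "\<dots> = \<alpha>" by (rule integral_indicator_translate)
        finally show ?thesis .
      qed
      have i1: "(\<integral>y. indicator A (y / a) \<partial>lborel) = a * \<alpha>"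
        using lborel_integral_real_affine[of "1 / a" "indicator A :: real \<Rightarrow> real" 0] a
        by (simp add: field_simps)
      have i2: "(\<integral>y. indicator A (y / a) * \<alpha> \<partial>leb_on {1..4}) = (\<integral>y. indicator A (y / a) \<partial>lborel) * \<alpha>"
      proof -
        \<comment> \<open>The dilate of \<open>A\<close> by \<open>a\<close> lies within
          \<open>{1..4}\<close>, since \<open>a\<close> and \<open>A\<close> lie in
          \<open>{1..2}\<close>; the cutoff has no effect.\<close>
        have eq: "indicator {1..4} y * indicator A (y / a) = (indicator A (y / a) :: real)" for y
        proof (cases "y / a \<in> A")
          case True
          then have "1 \<le> y / a" "y / a \<le> 2" using range by auto
          then have "a \<le> y" "y \<le> 2 * a" using a by (auto simp: field_simps)
          then show ?thesis using a by simp
        qed simp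
        have "(\<integral>y. indicator A (y / a) * \<alpha> \<partial>leb_on {1..4})
            = (\<integral>y. (indicator {1..4} y * indicator A (y / a)) * \<alpha> \<partial>lborel)"
          by (subst integral_leb_on) (auto simp: mult.assoc)
        then show ?thesis unfolding eq by simp
      qed
      have i3: "(\<integral>y. indicator A (y / a) * \<alpha> \<partial>leb_on {1..4}) \<le> (\<integral>y. H y \<partial>leb_on {1..4})"
      proof (rule integral_mono)
        interpret L: finite_measure "leb_on {1..4}" by (rule finite_measure_leb_on) auto
        show "integrable (leb_on {1..4}) (\<lambda>y. indicator A (y / a) * \<alpha>)"
          by (rule L.integrable_const_bound[where B = \<alpha>]) (auto simp: indicator_def)
        have "(\<lambda>y. H y) \<in> borel_measurable (leb_on {1..4})" unfolding H_def
        proof (rule finite_measure_measurable_integral)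
          show "(\<lambda>(y, x). F (y, x) a) \<in> borel_measurable leb_box"
            unfolding F_def grid_def by measurable
        qed (auto intro: finite_measure_leb_on)
        moreover have "\<bar>H y\<bar> \<le> 1 * measure (leb_on {0..8}) (space (leb_on {0..8}))" for y
          unfolding H_def by (rule abs_integral_le_const)
            (use F01 in \<open>auto intro: finite_measure_leb_on\<close>)
        ultimately show "integrable (leb_on {1..4}) H"
          by (intro L.integrable_const_bound[where B = "measure (leb_on {0..8}) UNIV"]) auto
        show "indicator A (y / a) * \<alpha> \<le> H y" for y
          using H_eq[of y] H0[of y] by (cases "y / a \<in> A") auto
      qed
      \<comment> \<open>The Jacobian \<open>a\<close> is at least 1 and can be discarded.\<close>
      have "\<alpha>\<^sup>2 \<le> a * \<alpha> * \<alpha>"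
        using mult_right_mono[OF a(1), of "\<alpha> * \<alpha>"] by (simp add: power2_eq_square mult.assoc)
      also have "\<dots> \<le> (\<integral>w. F w a \<partial>leb_box)" using i3 unfolding FH i2 i1 .
      finally show "\<alpha>\<^sup>2 \<le> (\<integral>w. F w a \<partial>leb_box)" .
    qed simp
  qed
  finally show ?thesis
    by (simp add: measure_leb_on_UNIV power2_eq_square power3_eq_cube mult.commute)
qed

text \<open>For fixed \<open>w\<close> and \<open>a\<close>, integrating the indicator over
  \<open>t\<close> in \<open>{0..\<rho>}\<close> measures \<open>A\<close> in a reflected interval
  of length \<rho>, at most \<open>B * \<rho> powr \<sigma>\<close>. The integrals over
  \<open>a\<close> and over the grid then contribute \<alpha> and the measure of P.\<close>

lemma integral_incidences_le:
  assumes "0 < \<rho>"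
  shows "\<bar>\<integral>t. incidences t \<partial>leb_on {0..\<rho>}\<bar> \<le> B * \<rho> powr \<sigma> * \<alpha> * (measure lborel X * measure lborel Y)"
proof -
  define h :: "real \<times> real \<Rightarrow> real \<Rightarrow> real"
    where "h w t = (\<integral>a. indicator A (snd w - t - fst w / a) \<partial>leb_on A)" for w t
  have fm: "finite_measure (leb_on {0..\<rho>})" by (auto intro: finite_measure_leb_on)
  have h1: "\<bar>h w t\<bar> \<le> \<alpha>" for w t unfolding h_def by (rule abs_indicator_integral_A_le)
  have "(\<integral>t. incidences t \<partial>leb_on {0..\<rho>}) = (\<integral>t. (\<integral>w. grid w * h w t \<partial>leb_box) \<partial>leb_on {0..\<rho>})"
    by (simp add: incidences_def h_def)
  also have "\<dots> = (\<integral>w. (\<integral>t. grid w * h w t \<partial>leb_on {0..\<rho>}) \<partial>leb_box)"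
  proof (rule Fubini_bounded(1)[OF fm finite_measure_leb_box, where c = \<alpha>])
    have [measurable]: "(\<lambda>z. h (snd z) (fst z)) \<in> borel_measurable (leb_on {0..\<rho>} \<Otimes>\<^sub>M leb_box)"
      unfolding h_def by (rule finite_measure_measurable_integral[OF finite_measure_A]) measurable
    show "(\<lambda>(t, w). grid w * h w t) \<in> borel_measurable (leb_on {0..\<rho>} \<Otimes>\<^sub>M leb_box)"
      unfolding case_prod_unfold by measurable
    show "\<bar>grid w * h w t\<bar> \<le> \<alpha>" for w t
      using mult_mono[OF grid_01(2)[of w] h1[of w t]] grid_01(1)[of w] by (simp add: abs_mult)
  qed
  also have "\<dots> = (\<integral>w. grid w * (\<integral>t. h w t \<partial>leb_on {0..\<rho>}) \<partial>leb_box)" by simp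
  also have "\<bar>\<dots>\<bar> \<le> (B * \<rho> powr \<sigma> * \<alpha>) * (measure lborel X * measure lborel Y)"
  proof (rule abs_integral_le_nn_integral)
    show "(\<integral>\<^sup>+w. ennreal (grid w) \<partial>leb_box) \<le> ennreal (measure lborel X * measure lborel Y)"
    proof -
      interpret finite_measure leb_box by (rule finite_measure_leb_box)
      have "integrable leb_box grid"
        by (rule integrable_const_bound[where B = 1]) (use grid_01 in auto)
      then show ?thesis unfolding measure_X_Y by (subst nn_integral_eq_integral) (auto simp: grid_01)
    qed
    show "AE w in leb_box. \<bar>grid w * (\<integral>t. h w t \<partial>leb_on {0..\<rho>})\<bar> \<le> B * \<rho> powr \<sigma> * \<alpha> * grid w"
    proof (rule AE_I2)
      fix w
      have "(\<integral>t. h w t \<partial>leb_on {0..\<rho>})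
        = (\<integral>a. (\<integral>t. indicator A (snd w - t - fst w / a) \<partial>leb_on {0..\<rho>}) \<partial>leb_on A)"
        unfolding h_def by (rule Fubini_bounded(1)[OF fm finite_measure_A, where c = 1]) auto
      also have "\<bar>\<dots>\<bar> \<le> B * \<rho> powr \<sigma> * \<alpha>"
      proof (rule abs_integral_A_le)
        fix a
        define u where "u = snd w - fst w / a"
        have "(\<integral>t. indicator A (snd w - t - fst w / a) \<partial>leb_on {0..\<rho>} :: real)
          = (\<integral>t. indicator {0..\<rho>} t * indicator A (u - t) \<partial>lborel)"
          by (subst integral_leb_on) (auto simp: u_def algebra_simps)
        also have "\<dots> = (\<integral>t. indicator (A \<inter> {u - \<rho>..u}) (u + (-1) * t) \<partial>lborel)"
          by (rule Bochner_Integration.integral_cong) (auto simp: indicator_def)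
        also have "\<dots> = measure lborel (A \<inter> {u - \<rho>..u})"
          using lborel_integral_real_affine[of "-1" "indicator (A \<inter> {u - \<rho>..u}) :: real \<Rightarrow> real" u] by simp
        finally show "\<bar>\<integral>t. indicator A (snd w - t - fst w / a) \<partial>leb_on {0..\<rho>}\<bar> \<le> B * \<rho> powr \<sigma>"
          using frostman[of "u - \<rho>" u] assms by simp
      qed (use B_nonneg in auto)
      finally show "\<bar>grid w * (\<integral>t. h w t \<partial>leb_on {0..\<rho>})\<bar> \<le> B * \<rho> powr \<sigma> * \<alpha> * grid w"
        using grid_01(1)[of w] mult_left_mono by (fastforce simp: abs_mult mult.commute)
    qed
  qed (use B_nonneg in auto)
  finally show ?thesis .
qed

text \<open>Cauchy-Schwarz is used in the form u v <= l u^2 / 2 + v^2 / (2 l), pointwise and with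
  \<open>l\<close> still free; \<open>grid\<close> equals its own square. Monotonicity in
  \<open>t\<close> makes the error uniform on \<open>{0..\<rho>}\<close>, ready for
  averaging.\<close>

lemma incidences_ge:
  assumes t: "0 \<le> t" "t \<le> \<rho>" "\<rho> \<le> 1" and l: "0 < l"
  shows "\<alpha> ^ 3 - (l * (measure lborel X * measure lborel Y) / 2
      + 8 * riesz_const \<sigma> * \<alpha>\<^sup>2 * B\<^sup>2 * \<rho> powr (\<sigma> - 1/2) / (2 * l)) \<le> incidences t"
proof (cases "t = 0")
  case True
  \<comment> \<open>The L2 bound requires a positive shift; at \<open>t = 0\<close> it suffices that
    the error terms are nonnegative.\<close>
  have "0 \<le> l * (measure lborel X * measure lborel Y) / 2
      + 8 * riesz_const \<sigma> * \<alpha>\<^sup>2 * B\<^sup>2 * \<rho> powr (\<sigma> - 1/2) / (2 * l)"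
    using l riesz_const_pos[OF sigma(1)] by simp
  then show ?thesis using incidences_0_ge True by simp
next
  case False
  interpret finite_measure leb_box by (rule finite_measure_leb_box)
  define h :: "real \<times> real \<Rightarrow> real \<Rightarrow> real"
    where "h w t = (\<integral>a. indicator A (snd w - t - fst w / a) \<partial>leb_on A)" for w t
  have h1: "\<bar>h w t\<bar> \<le> \<alpha>" for w t unfolding h_def by (rule abs_indicator_integral_A_le)
  have [measurable]: "(\<lambda>w. h w t) \<in> borel_measurable leb_box" for t
    unfolding h_def by (rule finite_measure_measurable_integral[OF finite_measure_A]) measurable
  have i1: "integrable leb_box (\<lambda>w. grid w * h w t)" for t
  proof (rule integrable_const_bound[where B = \<alpha>])
    show "AE w in leb_box. norm (grid w * h w t) \<le> \<alpha>"
    proof (rule AE_I2)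
      fix w show "norm (grid w * h w t) \<le> \<alpha>"
        using mult_mono[OF grid_01(2)[of w] h1[of w t]] grid_01(1)[of w] by (simp add: abs_mult)
    qed
  qed measurable
  have i2: "integrable leb_box grid"
    by (rule integrable_const_bound[where B = 1]) (use grid_01 in auto)
  have i3: "integrable leb_box (\<lambda>w. (avg_diff t w)\<^sup>2)"
  proof (rule integrable_const_bound[where B = "\<alpha>\<^sup>2"])
    have "(avg_diff t w)\<^sup>2 \<le> \<alpha>\<^sup>2" for w
      using power_mono[OF abs_avg_diff_le[of t w] abs_ge_zero, of 2] by simp
    then show "AE w in leb_box. norm ((avg_diff t w)\<^sup>2) \<le> \<alpha>\<^sup>2" by simp
  qed measurable
  have hh: "h w 0 - h w t = avg_diff t w" for w
  proof -
    interpret A: finite_measure "leb_on A" by (rule finite_measure_A)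
    have i: "integrable (leb_on A) (\<lambda>a. indicator A (snd w - t - fst w / a) :: real)" for t
      by (rule A.integrable_const_bound[where B = 1]) auto
    show ?thesis unfolding h_def avg_diff_def shift_diff_def
      using i[of 0] i[of t]
      by (subst Bochner_Integration.integral_diff[symmetric]) (simp_all add: algebra_simps)
  qed
  have "incidences 0 - incidences t = (\<integral>w. grid w * h w 0 - grid w * h w t \<partial>leb_box)"
    unfolding incidences_def h_def[symmetric] using i1 by simp
  also have "\<dots> = (\<integral>w. grid w * avg_diff t w \<partial>leb_box)"
    by (simp add: right_diff_distrib[symmetric] hh)
  also have "\<dots> \<le> (\<integral>w. l / 2 * grid w + 1 / (2 * l) * (avg_diff t w)\<^sup>2 \<partial>leb_box)"
  proof (rule integral_mono)
    show "integrable leb_box (\<lambda>w. grid w * avg_diff t w)"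
      using Bochner_Integration.integrable_diff[OF i1[of 0] i1[of t]]
      by (simp add: right_diff_distrib[symmetric] hh)
    show "integrable leb_box (\<lambda>w. l / 2 * grid w + 1 / (2 * l) * (avg_diff t w)\<^sup>2)"
      using i2 i3 by (intro Bochner_Integration.integrable_add integrable_mult_right)
    fix w
    consider "grid w = 0" | "grid w = 1" by (force simp: grid_def indicator_def)
    then show "grid w * avg_diff t w \<le> l / 2 * grid w + 1 / (2 * l) * (avg_diff t w)\<^sup>2"
    proof cases
      case 2
      have "0 \<le> (l - avg_diff t w)\<^sup>2 / (2 * l)" using l by simp
      also have "\<dots> = l / 2 + 1 / (2 * l) * (avg_diff t w)\<^sup>2 - avg_diff t w"
        using l by (simp add: power2_eq_square field_simps)
      finally show ?thesis using 2 by simp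
    qed (use l in simp)
  qed
  also have "\<dots> = l * (\<integral>w. grid w \<partial>leb_box) / 2 + (\<integral>w. (avg_diff t w)\<^sup>2 \<partial>leb_box) / (2 * l)"
    using i2 i3 by simp
  also have "(\<integral>w. (avg_diff t w)\<^sup>2 \<partial>leb_box) / (2 * l)
      \<le> 8 * riesz_const \<sigma> * \<alpha>\<^sup>2 * B\<^sup>2 * t powr (\<sigma> - 1/2) / (2 * l)"
    using integral_avg_diff_square_le[of t] t False l by (intro divide_right_mono) auto
  also have "\<dots> \<le> 8 * riesz_const \<sigma> * \<alpha>\<^sup>2 * B\<^sup>2 * \<rho> powr (\<sigma> - 1/2) / (2 * l)"
    using t l sigma riesz_const_pos[OF sigma(1)]
    by (intro divide_right_mono mult_left_mono powr_mono2) auto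
  finally show ?thesis using incidences_0_ge by (simp add: measure_X_Y)
qed

text \<open>Averaging the lower bound for T over \<open>{0..\<rho>}\<close> and comparing with the
  upper bound for the average leaves the two parameters \<open>l\<close> and \<rho>. Here
  \<open>l\<close> is optimised up to constants, while \<rho> stays free.\<close>

lemma frostman_sum_product:
  assumes \<rho>: "0 < \<rho>" "\<rho> \<le> 1" and pos: "0 < \<alpha>"
  shows "\<alpha> ^ 3 \<le> 2 * (measure lborel X * measure lborel Y) *
    (\<alpha> * B * \<rho> powr (\<sigma> - 1) + 8 * riesz_const \<sigma> * B\<^sup>2 * \<rho> powr (\<sigma> - 1/2) / \<alpha>)"
proof -
  define p where "p = measure lborel X * measure lborel Y"
  define S where "S = 8 * riesz_const \<sigma> * \<alpha>\<^sup>2 * B\<^sup>2 * \<rho> powr (\<sigma> - 1/2)"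
  have p0: "0 \<le> p" by (simp add: p_def)
  interpret L: finite_measure "leb_on {0..\<rho>}" by (rule finite_measure_leb_on) auto
  have bound: "\<rho> * (\<alpha> ^ 3 - (l * p / 2 + S / (2 * l))) \<le> B * \<rho> powr \<sigma> * \<alpha> * p" if "0 < l" for l
  proof -
    have "(\<integral>t. \<alpha> ^ 3 - (l * p / 2 + S / (2 * l)) \<partial>leb_on {0..\<rho>}) \<le> (\<integral>t. incidences t \<partial>leb_on {0..\<rho>})"
    proof (rule integral_mono_AE)
      have "\<bar>incidences t\<bar> \<le> \<alpha> * measure leb_box (space leb_box)" for t
        unfolding incidences_def
      proof (rule abs_integral_le_const[OF finite_measure_leb_box], simp, rule AE_I2)
        fix w
        show "\<bar>grid w * (\<integral>a. indicator A (snd w - t - fst w / a) \<partial>leb_on A)\<bar> \<le> \<alpha>"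
          using mult_mono[OF grid_01(2)[of w] abs_indicator_integral_A_le] grid_01(1)[of w]
          by (simp add: abs_mult)
      qed
      moreover have "incidences \<in> borel_measurable (leb_on {0..\<rho>})"
      proof -
        have [measurable]: "(\<lambda>z. \<integral>a. indicator A (snd (snd z) - fst z - fst (snd z) / a) \<partial>leb_on A :: real)
            \<in> borel_measurable (leb_on {0..\<rho>} \<Otimes>\<^sub>M leb_box)"
          by (rule finite_measure_measurable_integral[OF finite_measure_A]) measurable
        show ?thesis unfolding incidences_def[abs_def]
          by (rule finite_measure_measurable_integral[OF finite_measure_leb_box])
             (unfold case_prod_unfold, measurable)
      qed
      ultimately show "integrable (leb_on {0..\<rho>}) incidences"
        by (intro L.integrable_const_bound[where B = "\<alpha> * measure leb_box (space leb_box)"]) auto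
      show "AE t in leb_on {0..\<rho>}. \<alpha> ^ 3 - (l * p / 2 + S / (2 * l)) \<le> incidences t"
        by (rule AE_leb_on) (use incidences_ge[OF _ _ \<rho>(2) that] in \<open>auto simp: p_def S_def\<close>)
    qed simp
    also have "\<dots> \<le> B * \<rho> powr \<sigma> * \<alpha> * p"
      using integral_incidences_le[OF \<rho>(1)] by (simp add: p_def)
    finally show ?thesis using \<rho> by (simp add: measure_leb_on_UNIV)
  qed
  have bound': "\<alpha> ^ 3 - (l * p / 2 + S / (2 * l)) \<le> B * \<rho> powr (\<sigma> - 1) * \<alpha> * p" if "0 < l" for l
    using bound[OF that] \<rho> by (simp add: powr_diff field_simps)
  show ?thesis
  proof (cases "p = 0")
    case True
    \<comment> \<open>With \<open>p = 0\<close> the bound reads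
      \<open>\<alpha> ^ 3 \<le> S / (2 * l)\<close> for every positive \<open>l\<close>; this choice
      turns it into \<open>S + 1 \<le> S / 2\<close>, a contradiction.\<close>
    define l where "l = (S + 1) / \<alpha> ^ 3"
    have S0: "0 \<le> S" using riesz_const_pos[OF sigma(1)] by (simp add: S_def)
    have l: "0 < l" "\<alpha> ^ 3 * l = S + 1" using S0 pos by (auto simp: l_def)
    have "\<alpha> ^ 3 * l \<le> S / 2" using bound'[OF l(1)] True l(1) by (simp add: field_simps)
    then show ?thesis using l(2) S0 by simp
  next
    case False
    then have p: "0 < p" using p0 by simp
    have absorb: "z \<le> 2 * (u + v)" if "z - (z / 4 + v') \<le> u" "v' = v" "0 \<le> u" "0 \<le> v" for z u v v' :: real
      using that by (simp add: field_simps)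
    \<comment> \<open>The choice \<open>l = \<alpha> ^ 3 / (2 * p)\<close> makes the first error
      term exactly a quarter of the main term, which is absorbed on the left.\<close>
    have "\<alpha> ^ 3 - (\<alpha> ^ 3 / 4 + S * p / \<alpha> ^ 3) \<le> B * \<rho> powr (\<sigma> - 1) * \<alpha> * p"
      using bound'[of "\<alpha> ^ 3 / (2 * p)"] p pos by simp
    moreover have "S * p / \<alpha> ^ 3 = p * (8 * riesz_const \<sigma> * B\<^sup>2 * \<rho> powr (\<sigma> - 1/2) / \<alpha>)"
      using pos by (simp add: S_def power2_eq_square power3_eq_cube)
    moreover have "0 \<le> B * \<rho> powr (\<sigma> - 1) * \<alpha> * p" 
      "0 \<le> p * (8 * riesz_const \<sigma> * B\<^sup>2 * \<rho> powr (\<sigma> - 1/2) / \<alpha>)"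
      using p B_nonneg riesz_const_pos[OF sigma(1)] by auto
    ultimately have "\<alpha> ^ 3 \<le> 2 * (B * \<rho> powr (\<sigma> - 1) * \<alpha> * p + p * (8 * riesz_const \<sigma> * B\<^sup>2 * \<rho> powr (\<sigma> - 1/2) / \<alpha>))"
      by (rule absorb)
    then show ?thesis by (simp add: p_def algebra_simps)
  qed
qed

end

end

section \<open>Discretized sets: measurability, Frostman condition and conclusion\<close>

text \<open>A set without two distinct points has measure 0, against the lower bound on the lengths
  of the intervals.\<close>

lemma delta_discretized_nondegenerate:
  assumes "delta_discretized C K \<epsilon> \<delta> A" and "0 < \<delta>"
  shows "\<exists>\<I>. A = \<Union>\<I> \<and> (\<forall>I\<in>\<I>. is_interval I \<and> (\<exists>x\<in>I. \<exists>y\<in>I. x < y))"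
proof -
  from assms(1) obtain \<I> where \<I>: "A = \<Union>\<I>"
    "\<And>I. I \<in> \<I> \<Longrightarrow> is_interval I \<and> approx C K \<epsilon> \<delta> (measure lebesgue I) \<delta>"
    unfolding delta_discretized_def by auto
  have "\<exists>x\<in>I. \<exists>y\<in>I. x < y" if "I \<in> \<I>" for I
  proof (rule ccontr)
    assume "\<not> (\<exists>x\<in>I. \<exists>y\<in>I. x < y)"
    then have "x = y" if "x \<in> I" "y \<in> I" for x y using that by (meson linorder_neqE)
    then have "I = {} \<or> (\<exists>x. I = {x})" by blast
    then have "measure lebesgue I = 0" by auto
    moreover have "lessapprox C K \<epsilon> \<delta> \<delta> (measure lebesgue I)"
      using \<I>(2)[OF that] by (simp add: approx_def)
    ultimately show False using assms(2) by (simp add: lessapprox_def)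
  qed
  then show ?thesis using \<I> by (intro exI[of _ \<I>]) auto
qed

text \<open>Positivity of \<open>A\<close> makes multiplication strictly increasing in its first
  factor, as the image lemma for intervals demands.\<close>

lemma delta_discretized_borel:
  assumes "delta_discretized C K \<epsilon> \<delta> A" "0 < \<delta>" and A: "A \<subseteq> {0<..}"
  shows "A \<in> sets borel" "A + A \<in> sets borel" "A * A \<in> sets borel"
proof -
  obtain \<I> where \<I>: "A = \<Union>\<I>" "\<And>I. I \<in> \<I> \<Longrightarrow> is_interval I"
    "\<And>I. I \<in> \<I> \<Longrightarrow> \<exists>x\<in>I. \<exists>y\<in>I. x < y"
    using delta_discretized_nondegenerate[OF assms(1,2)] by metis
  show "A \<in> sets borel"
    unfolding \<I>(1) using \<I>(2,3) by (rule Union_nondegenerate_intervals_borel)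
  have "{x + y |x y. x \<in> \<Union>\<I> \<and> y \<in> \<Union>\<I>} \<in> sets borel"
    using \<I>(2,3)
    by (rule borel_image2_nondegenerate_intervals) (auto simp: case_prod_unfold intro!: continuous_intros)
  also have "{x + y |x y. x \<in> \<Union>\<I> \<and> y \<in> \<Union>\<I>} = A + A"
    unfolding \<I>(1)[symmetric] set_plus_def by blast
  finally show "A + A \<in> sets borel" .
  have "{x * y |x y. x \<in> \<Union>\<I> \<and> y \<in> \<Union>\<I>} \<in> sets borel"
    using \<I>(2,3)
  proof (rule borel_image2_nondegenerate_intervals)
    show "x * y < x' * y" if "y \<in> \<Union>\<I>" "x < x'" for x x' y
      using that A unfolding \<I>(1)[symmetric] by (intro mult_strict_right_mono) auto
  qed (auto simp: case_prod_unfold intro!: continuous_intros)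
  also have "{x * y |x y. x \<in> \<Union>\<I> \<and> y \<in> \<Union>\<I>} = A * A"
    unfolding \<I>(1)[symmetric] set_times_def by blast
  finally show "A * A \<in> sets borel" .
qed

text \<open>Three ranges of the length r. Below \<delta>, the length itself is a bound, and r =
  r^(1-\<sigma>) r^\<sigma> with r < \<delta>. From \<delta> to 1, the definition applies, as
  \<delta> (r/\<delta>)^\<sigma> = \<delta>^(1-\<sigma>) r^\<sigma>. From 1 on, the total mass
  \<delta>^(1-\<sigma>) is a bound. The summand 1 in \<open>K \<epsilon> + 1\<close> covers the two
  outer ranges, where the constant is 1.\<close>

lemma frostman_set_of_delta_sigma_set:
  assumes A: "delta_sigma_set M C K \<epsilon> \<delta> \<sigma> A" "A \<subseteq> {1..2}" "measure lebesgue A = \<delta> powr (1 - \<sigma>)"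
    and \<delta>: "0 < \<delta>" "\<delta> < 1" and \<sigma>: "1/2 < \<sigma>" "\<sigma> < 1"
    and pos: "0 \<le> C" "0 \<le> \<epsilon>" "0 \<le> K \<epsilon>"
  shows "frostman_set A ((K \<epsilon> + 1) * \<delta> powr (- (C * \<epsilon>)) * \<delta> powr (1 - \<sigma>)) \<sigma>"
proof
  show [measurable]: "A \<in> sets borel"
    using A \<delta> by (intro delta_discretized_borel(1)[of C K \<epsilon> \<delta>]) (auto simp: delta_sigma_set_def)
  have fin: "A \<in> fmeasurable lborel"
    using emeasure_bounded_finite[of A] bounded_subset[OF bounded_closed_interval A(2)]
    by (intro fmeasurableI) auto
  define D where "D = \<delta> powr (- (C * \<epsilon>))"
  have "1 \<le> D" using \<delta> pos powr_mono'[of "- (C * \<epsilon>)" 0 \<delta>] by (simp add: D_def)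
  have D: "1 \<le> (K \<epsilon> + 1) * D" "K \<epsilon> * D \<le> (K \<epsilon> + 1) * D" 
    using \<open>1 \<le> D\<close> pos mult_mono[of 1 "K \<epsilon> + 1" 1 D] by (auto simp: algebra_simps)
  fix p q :: real assume "p < q"
  define r where "r = q - p"
  have r: "0 < r" using \<open>p < q\<close> by (simp add: r_def)
  consider "r < \<delta>" | "\<delta> \<le> r" "r < 1" | "1 \<le> r" by linarith
  then have "\<exists>x \<le> (K \<epsilon> + 1) * D. measure lborel (A \<inter> {p..q}) \<le> x * (\<delta> powr (1 - \<sigma>) * r powr \<sigma>)"
  proof cases
    case 1
    have "measure lborel (A \<inter> {p..q}) \<le> measure lborel {p..q}"
      by (rule measure_mono_fmeasurable) (auto simp: fmeasurable_def emeasure_lborel_Icc_eq)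
    also have "\<dots> = r powr (1 - \<sigma>) * r powr \<sigma>"
      using r by (simp add: r_def powr_add[symmetric])
    also have "\<dots> \<le> \<delta> powr (1 - \<sigma>) * r powr \<sigma>"
      using r 1 \<sigma> by (intro mult_right_mono powr_mono2) auto
    finally show ?thesis using D(1) by (intro exI[of _ 1]) simp
  next
    case 2
    \<comment> \<open>The open ball about the midpoint with radius equal to the full length contains
      the closed interval.\<close>
    define x where "x = (p + q) / 2"
    have "measure lborel (A \<inter> {p..q}) \<le> measure lborel (A \<inter> ball x r)"
    proof (rule measure_mono_fmeasurable)
      show "A \<inter> {p..q} \<subseteq> A \<inter> ball x r"
        using r by (auto simp: x_def r_def dist_real_def abs_if field_simps)
      show "A \<inter> ball x r \<in> fmeasurable lborel" using fin by (rule fmeasurable_Int_fmeasurable) auto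
    qed simp
    also have "\<dots> = measure lebesgue (A \<inter> ball x r)" by simp
    also have "\<dots> \<le> K \<epsilon> * D * (\<delta> * (r / \<delta>) powr \<sigma>)"
      using A(1) 2 \<delta> unfolding delta_sigma_set_def lessapprox_def D_def
      by (auto dest!: spec[of _ r] spec[of _ x])
    also have "\<delta> * (r / \<delta>) powr \<sigma> = \<delta> powr (1 - \<sigma>) * r powr \<sigma>"
      using \<delta> r by (simp add: powr_divide powr_diff)
    finally show ?thesis using D(2) by blast
  next
    case 3
    have "measure lborel (A \<inter> {p..q}) \<le> measure lborel A"
      using fin by (intro measure_mono_fmeasurable) auto
    also have "\<dots> = \<delta> powr (1 - \<sigma>)" using A(3) by simp
    also have "\<dots> \<le> \<delta> powr (1 - \<sigma>) * r powr \<sigma>"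
      using mult_left_mono[OF ge_one_powr_ge_zero[OF 3, of \<sigma>], of "\<delta> powr (1 - \<sigma>)"] \<sigma> by simp
    finally show ?thesis using D(1) by (intro exI[of _ 1]) simp
  qed
  then obtain x where "x \<le> (K \<epsilon> + 1) * D"
    "measure lborel (A \<inter> {p..q}) \<le> x * (\<delta> powr (1 - \<sigma>) * r powr \<sigma>)" by blast
  moreover from this have "x * (\<delta> powr (1 - \<sigma>) * r powr \<sigma>) \<le> (K \<epsilon> + 1) * D * (\<delta> powr (1 - \<sigma>) * r powr \<sigma>)"
    by (intro mult_right_mono) auto
  ultimately show "measure lborel (A \<inter> {p..q})
      \<le> (K \<epsilon> + 1) * \<delta> powr (- (C * \<epsilon>)) * \<delta> powr (1 - \<sigma>) * (q - p) powr \<sigma>"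
    by (simp add: D_def r_def mult.assoc)
qed (use A \<sigma> in auto)

text \<open>The witnesses are the same exponent constant \<open>C\<close>, a multiple of
  \<open>K \<epsilon> + 1\<close>, and the threshold 1 for \<delta>. The loss \<open>L\<close>
  enters the bound for the product of the two measures squared, but the sum of the measures only
  linearly after a square root, so \<open>C\<close> does not grow.\<close>

theorem theorem1p1:
  fixes \<sigma> M C :: real and K :: "real \<Rightarrow> real"
  assumes "1/2 < \<sigma>" and "\<sigma> < 1" and "M > 0"
    and "C > 0" and "\<And>\<epsilon>. \<epsilon> > 0 \<Longrightarrow> K \<epsilon> > 0"
  shows "\<exists>C' K'. C' > 0 \<and> (\<forall>\<epsilon>>0. K' \<epsilon> > 0) \<and>
    (\<forall>\<epsilon>>0. \<exists>\<delta>\<^sub>0>0. \<forall>\<delta> A.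
       0 < \<delta> \<and> \<delta> < \<delta>\<^sub>0 \<and> A \<subseteq> {1..2} \<and> delta_sigma_set M C K \<epsilon> \<delta> \<sigma> A \<and>
       measure lebesgue A = \<delta> powr (1 - \<sigma>) \<longrightarrow>
       lessapprox C' K' \<epsilon> \<delta>
         (\<delta> powr (- ((1 - \<sigma>) * (2 * \<sigma> - 1) / (6 * \<sigma> + 4))) * measure lebesgue A)
         (measure lebesgue (A + A) + measure lebesgue (A * A)))"
proof -
  \<comment> \<open>In R^2, the factor 2 comes from \<open>frostman_sum_product\<close> and the
    bracket from its two terms, which become comparable below.\<close>
  define R where "R = sqrt (2 * (1 + 8 * riesz_const \<sigma>))"
  have c0: "0 < riesz_const \<sigma>" using assms(1) by (rule riesz_const_pos)
  have R0: "0 < R" using c0 by (simp add: R_def)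
  have main: "lessapprox C (\<lambda>\<epsilon>. R * (K \<epsilon> + 1)) \<epsilon> \<delta>
         (\<delta> powr (- ((1 - \<sigma>) * (2 * \<sigma> - 1) / (6 * \<sigma> + 4))) * measure lebesgue A)
         (measure lebesgue (A + A) + measure lebesgue (A * A))"
    if \<epsilon>: "0 < \<epsilon>" and \<delta>: "0 < \<delta>" "\<delta> < 1" and A: "A \<subseteq> {1..2}" "delta_sigma_set M C K \<epsilon> \<delta> \<sigma> A"
      "measure lebesgue A = \<delta> powr (1 - \<sigma>)" for \<epsilon> \<delta> A
  proof -
    define L where "L = (K \<epsilon> + 1) * \<delta> powr (- (C * \<epsilon>))"
    define a where "a = \<delta> powr (1 - \<sigma>)"
    have Ke: "0 < K \<epsilon>" using assms(5) \<epsilon> .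
    have a: "0 < a" "a \<le> 1" using \<delta> assms(2) by (auto simp: a_def powr_le1)
    have "1 \<le> \<delta> powr (- (C * \<epsilon>))"
      using \<delta> assms(4) \<epsilon> powr_mono'[of "- (C * \<epsilon>)" 0 \<delta>] by simp
    then have L: "1 \<le> L" using mult_mono[of 1 "K \<epsilon> + 1" 1 "\<delta> powr (- (C * \<epsilon>))"] Ke by (simp add: L_def)
    interpret F: frostman_set A "L * a" \<sigma>
      unfolding L_def a_def
      using frostman_set_of_delta_sigma_set[OF A(2,1,3) \<delta> assms(1,2)] assms(4) \<epsilon> Ke by simp
    \<comment> \<open>On Borel sets \<open>lebesgue\<close> and \<open>lborel\<close> have the same
      values, which transfers the bounds for A+A and AA to the measure in the statement.\<close>
    have borel: "A \<in> sets borel" "A + A \<in> sets borel" "A * A \<in> sets borel"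
      using A \<delta> by (auto intro!: delta_discretized_borel[of C K \<epsilon> \<delta> A] simp: delta_sigma_set_def)
    have mA: "measure lborel A = a" using A(3) borel by (simp add: a_def)
    have sq: "(a\<^sup>2) powr x = a powr (2 * x)" for x
      using a by (simp add: powr_powr flip: powr_numeral)
    have sq': "(a powr x)\<^sup>2 = a powr (2 * x)" for x
      by (simp add: power2_eq_square flip: powr_add)
    define p where "p = measure lborel (A + A) * measure lborel (A * A)"
    define s where "s = measure lborel (A + A) + measure lborel (A * A)"
    have s0: "0 \<le> s" by (simp add: s_def)
    have p0: "0 \<le> p" by (simp add: p_def)
    have ps: "p \<le> s\<^sup>2" by (simp add: p_def s_def power2_eq_square algebra_simps)
    \<comment> \<open>The average is taken over shifts up to \<open>a\<^sup>2\<close>; with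
      \<open>B = L * a\<close> this makes both terms multiples of
      \<open>a powr (2 * \<sigma>)\<close>.\<close>
    have "measure lborel A ^ 3 \<le> 2 * (measure lborel (A + A) * measure lborel (A * A)) *
        (measure lborel A * (L * a) * (a\<^sup>2) powr (\<sigma> - 1)
        + 8 * riesz_const \<sigma> * (L * a)\<^sup>2 * (a\<^sup>2) powr (\<sigma> - 1/2) / measure lborel A)"
    proof (rule F.frostman_sum_product)
      show "A + A \<subseteq> {0..8}" 
      proof
        fix z assume "z \<in> A + A"
        then obtain x y where xy: "z = x + y" "x \<in> A" "y \<in> A" by (auto simp: set_plus_def)
        then have "1 \<le> x" "x \<le> 2" "1 \<le> y" "y \<le> 2" using A(1) by auto
        then show "z \<in> {0..8}" by (simp add: xy)
      qed
      show "A * A \<subseteq> {1..4}"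
      proof
        fix z assume "z \<in> A * A"
        then obtain x y where xy: "z = x * y" "x \<in> A" "y \<in> A" by (auto simp: set_times_def)
        then have "1 \<le> x" "x \<le> 2" "1 \<le> y" "y \<le> 2" using A(1) by auto
        then have "1 * 1 \<le> x * y" "x * y \<le> 2 * 2" by (intro mult_mono; simp)+
        then show "z \<in> {1..4}" by (simp add: xy)
      qed
      show "x + y \<in> A + A" "x * y \<in> A * A" if "x \<in> A" "y \<in> A" for x y
        using that by (rule set_plus_intro, rule set_times_intro)
    qed (use borel a mA in \<open>simp_all add: power_le_one\<close>)
    then have "a ^ 3 \<le> 2 * p * (a * (L * a) * (a\<^sup>2) powr (\<sigma> - 1)
        + 8 * riesz_const \<sigma> * (L * a)\<^sup>2 * (a\<^sup>2) powr (\<sigma> - 1/2) / a)"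
      unfolding mA p_def .
    also have "a * (L * a) * (a\<^sup>2) powr (\<sigma> - 1) = L * a powr (2 * \<sigma>)"
    proof -
      have "(a\<^sup>2) powr (\<sigma> - 1) = a powr (2 * \<sigma>) / a\<^sup>2"
        using a by (simp add: sq right_diff_distrib powr_diff)
      then show ?thesis using a by (simp add: power2_eq_square)
    qed
    also have "8 * riesz_const \<sigma> * (L * a)\<^sup>2 * (a\<^sup>2) powr (\<sigma> - 1/2) / a = 8 * riesz_const \<sigma> * L\<^sup>2 * a powr (2 * \<sigma>)"
    proof -
      have "(a\<^sup>2) powr (\<sigma> - 1/2) = a powr (2 * \<sigma>) / a"
        using a by (simp add: sq right_diff_distrib powr_diff)
      then show ?thesis using a by (simp add: power2_eq_square)
    qed
    \<comment> \<open>As \<open>L \<ge> 1\<close>, the linear loss is dominated by the quadratic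
      one.\<close>
    also have "2 * p * (L * a powr (2 * \<sigma>) + 8 * riesz_const \<sigma> * L\<^sup>2 * a powr (2 * \<sigma>))
        \<le> 2 * p * (L\<^sup>2 * a powr (2 * \<sigma>) + 8 * riesz_const \<sigma> * L\<^sup>2 * a powr (2 * \<sigma>))"
      using L p0 by (intro mult_left_mono add_mono mult_right_mono) (auto simp: power2_eq_square)
    also have "\<dots> = R\<^sup>2 * L\<^sup>2 * a powr (2 * \<sigma>) * p"
      using c0 by (simp add: R_def algebra_simps)
    also have "\<dots> \<le> R\<^sup>2 * L\<^sup>2 * a powr (2 * \<sigma>) * s\<^sup>2"
      using ps by (intro mult_left_mono) auto
    also have "\<dots> = (R * L * a powr \<sigma> * s)\<^sup>2"
      by (simp add: power_mult_distrib sq')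
    finally have "a ^ 3 \<le> (R * L * a powr \<sigma> * s)\<^sup>2" .
    also have "a ^ 3 = (a powr (3/2))\<^sup>2"
      using a by (simp add: sq')
    finally have "a powr (3/2) \<le> R * L * a powr \<sigma> * s"
      by (rule power2_le_imp_le) (use R0 L s0 in auto)
    then have "a powr (3/2) / a powr \<sigma> \<le> R * L * s"
      using a by (simp add: pos_divide_le_eq mult_ac)
    then have "a powr (3/2 - \<sigma>) \<le> R * L * s"
      by (simp only: powr_diff)
    moreover have "\<delta> powr (- ((1 - \<sigma>) * (2 * \<sigma> - 1) / (6 * \<sigma> + 4))) * a \<le> a powr (3/2 - \<sigma>)"
    proof -
      \<comment> \<open>The argument yields the denominator 2, and \<open>6 * \<sigma> + 4\<close>
        is larger; since \<delta> < 1, the smaller exponent asks for less.\<close>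
      have "(1 - \<sigma>) * (2 * \<sigma> - 1) / (6 * \<sigma> + 4) \<le> (1 - \<sigma>) * (2 * \<sigma> - 1) / 2"
        using assms(1,2) by (intro divide_left_mono) auto
      then have "\<delta> powr (- ((1 - \<sigma>) * (2 * \<sigma> - 1) / (6 * \<sigma> + 4))) \<le> \<delta> powr (- ((1 - \<sigma>) * (2 * \<sigma> - 1) / 2))"
        using \<delta> by (intro powr_mono') auto
      also have "\<dots> = a powr (1/2 - \<sigma>)"
      proof -
        have "- ((1 - \<sigma>) * (2 * \<sigma> - 1) / 2) = (1 - \<sigma>) * (1/2 - \<sigma>)"
          by (simp add: field_simps)
        then show ?thesis by (simp only: a_def powr_powr)
      qed
      finally have "\<delta> powr (- ((1 - \<sigma>) * (2 * \<sigma> - 1) / (6 * \<sigma> + 4))) * a \<le> a powr (1/2 - \<sigma>) * a"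
        using a by (intro mult_right_mono) auto
      also have "\<dots> = a powr (3/2 - \<sigma>)"
        using a powr_add[of a "1/2 - \<sigma>" 1] by simp
      finally show ?thesis .
    qed
    ultimately show ?thesis
      using a s0 borel A(3) by (simp add: lessapprox_def s_def a_def L_def abs_mult mult.assoc)
  qed
  show ?thesis
    by (rule exI[of _ C], rule exI[of _ "\<lambda>\<epsilon>. R * (K \<epsilon> + 1)"])
       (use main R0 assms(4,5) in \<open>auto simp: add_pos_pos intro!: exI[of _ 1]\<close>)
qed

end
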